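(* Let $n \geq 2$ be an arbitrary integer and, for $p > -1$, let $$M_p(x_1, \dots, x_n) = \mathbb{E}\left[\left(\sum_{j=1}^n \sqrt{x_j}\,\mathcal{E}_j\right)^p\right], \qquad x_1, \dots, x_n \geq 0,$$ where $\mathcal{E}_1, \dots, \mathcal{E}_n$ are i.i.d. standard exponential random variables. Then $M_p$ is Schur-convex on $\mathbb{R}_+^n$ for $-1 < p < 0$, and Schur-concave on $\mathbb{R}_+^n$ for $0 \leq p \leq 4$. Moreover, for every $p > 4$, the function $M_p$ is not Schur-monotone on $\mathbb{R}_+^n$, that is, it is neither Schur-convex nor Schur-concave.
   Context: A standard exponential random variable has density $e^{-x}\mathbf{1}_{[0,+\infty)}(x)$ on $\mathbb{R}$. Here $\mathbb{R}_+^n = [0,+\infty)^n$. For $x, y \in \mathbb{R}^n$, $x$ is majorised by $y$ ($x \prec y$) if $\sum_{j=1}^n x_j = \sum_{j=1}^n y_j$ and, for each $1 \le k \le n$, the sum of the $k$ largest entries of $x$ is at most the sum of the $k$ largest entries of $y$. A function $f$ on $\mathbb{R}_+^n$ is Schur-convex if $x \prec y$ implies $f(x) \leq f(y)$, and Schur-concave if $x \prec y$ implies $f(x) \geq f(y)$. Conventions at the origin: $M_p(0,\dots,0) = +\infty$ for $-1<p<0$ and $M_0 \equiv 1$; the origin is comparable in the majorisation order on $\mathbb{R}_+^n$ only with itself. *)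

theory Defs
  imports "HOL-Probability.Probability"
begin

definition entries_decreasing :: "real ^ 'n \<Rightarrow> real list" where
  "entries_decreasing x =
     rev (sorted_list_of_multiset (image_mset (\<lambda>j. x $ j) (mset_set UNIV)))"

definition majorised :: "real ^ 'n \<Rightarrow> real ^ 'n \<Rightarrow> bool" where
  "majorised x y \<longleftrightarrow>
     (\<Sum>j\<in>UNIV. x $ j) = (\<Sum>j\<in>UNIV. y $ j) \<and>
     (\<forall>k\<in>{1..CARD('n)}.
        sum_list (take k (entries_decreasing x)) \<le> sum_list (take k (entries_decreasing y)))"

definition nonneg_orthant :: "(real ^ 'n) set" where
  "nonneg_orthant = {x. \<forall>j. 0 \<le> x $ j}"

definition schur_convex_on :: "(real ^ 'n) set \<Rightarrow> (real ^ 'n \<Rightarrow> 'b::ord) \<Rightarrow> bool" where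
  "schur_convex_on A f \<longleftrightarrow> (\<forall>x\<in>A. \<forall>y\<in>A. majorised x y \<longrightarrow> f x \<le> f y)"

definition schur_concave_on :: "(real ^ 'n) set \<Rightarrow> (real ^ 'n \<Rightarrow> 'b::ord) \<Rightarrow> bool" where
  "schur_concave_on A f \<longleftrightarrow> (\<forall>x\<in>A. \<forall>y\<in>A. majorised x y \<longrightarrow> f y \<le> f x)"

(* Unlike powr, which sends base 0 to 0 for every exponent, this takes the values
   0^p = \<infinity> for p < 0 and 0^0 = 1.  It is only meant for bases s \<ge> 0. *)
definition epowr :: "real \<Rightarrow> real \<Rightarrow> ennreal" where
  "epowr s p =
     (if s = 0 then (if p < 0 then \<infinity> else if p = 0 then 1 else 0)
      else ennreal (s powr p))"

(* The expectation is taken in [0, \<infinity>].  The base of the power is almost surely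
   nonnegative when the E j are exponential variables.  At x = 0 the value is \<infinity> for p < 0
   and 1 for p = 0. *)
definition sqrt_sum_moment ::
    "'w measure \<Rightarrow> ('n::finite \<Rightarrow> 'w \<Rightarrow> real) \<Rightarrow> real \<Rightarrow> real ^ 'n \<Rightarrow> ennreal" where
  "sqrt_sum_moment W E p x = (\<integral>\<^sup>+ \<omega>. epowr (\<Sum>j\<in>UNIV. sqrt (x $ j) * E j \<omega>) p \<partial>W)"

end

theory Submission
  imports Defs "HOL-Real_Asymp.Real_Asymp"
begin

text \<open>
  A chain of transfers between two coordinates realises majorisation, so by independence it is enough to
  compare \<open>a E\<^sub>1 + b E\<^sub>2 + s\<close> with \<open>a' E\<^sub>1 + b' E\<^sub>2 + s\<close>, where \<open>s \<ge> 0\<close> is a constant,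
  \<open>a\<^sup>2 + b\<^sup>2 = a'\<^sup>2 + b'\<^sup>2\<close> and \<open>b < b' \<le> a' < a\<close>.  The logarithm of the ratio of the densities of
  \<open>a' E\<^sub>1 + b' E\<^sub>2\<close> and \<open>a E\<^sub>1 + b E\<^sub>2\<close> is concave, so the difference of the densities is nonnegative
  exactly on an interval.  The two densities have equal mass, and the balanced sum has the larger fourth
  moment about \<open>- s\<close>.  For \<open>p < 4\<close>, subtracting from the \<open>p\<close>-th power the affine function of the fourth
  power that agrees with it at the endpoints of the interval leaves an integrand of constant sign; this
  gives the inequality because \<open>u \<mapsto> u powr (p / 4)\<close> is increasing and concave for \<open>0 < p < 4\<close>, and
  decreasing and convex for \<open>p < 0\<close>.

  For \<open>p > 4\<close> the \<open>p\<close>-th moment of \<open>a E\<^sub>1 + b E\<^sub>2\<close> is \<open>\<Gamma> (p + 1)\<close> times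
  \<open>(a powr (p + 1) - b powr (p + 1)) / (a - b)\<close>.  On the circle this increases as \<open>b\<close> leaves \<open>0\<close>, and
  has a strict local minimum at \<open>a = b\<close>.
\<close>

subsection \<open>Majorisation and transfers\<close>

text \<open>Sorting the indices by their entries, instead of sorting the entries, keeps track of
  where each value sits; sums of largest entries thereby become sums over explicit index
  sets.\<close>

lemma entries_decreasing_enumeration:
  fixes x :: "real ^ 'n"
  obtains js where "distinct js" "set js = UNIV" "entries_decreasing x = map (\<lambda>j. x $ j) js"
    "\<And>i k. i \<le> k \<Longrightarrow> k < CARD('n) \<Longrightarrow> x $ (js ! k) \<le> x $ (js ! i)"
proof -
  obtain xs :: "'n list" where xs: "set xs = UNIV" "distinct xs"
    using finite_distinct_list[OF finite_class.finite_UNIV] by blast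
  let ?ys = "sort_key (\<lambda>j. x $ j) xs"
  have "mset (map (\<lambda>j. x $ j) ?ys) = image_mset (\<lambda>j. x $ j) (mset_set UNIV)"
    using xs mset_set_set[of xs] by simp
  then have "sorted_list_of_multiset (image_mset (\<lambda>j. x $ j) (mset_set UNIV))
      = sorted_list_of_multiset (mset (map (\<lambda>j. x $ j) ?ys))" by simp
  also have "\<dots> = sort (map (\<lambda>j. x $ j) ?ys)" by (rule sorted_list_of_multiset_mset)
  also have "\<dots> = map (\<lambda>j. x $ j) ?ys" by (simp add: sorted_sort_id)
  finally have eq: "entries_decreasing x = map (\<lambda>j. x $ j) (rev ?ys)"
    by (simp add: entries_decreasing_def rev_map)
  have len: "length xs = CARD('n)" using xs distinct_card[of xs] by simp
  have "sorted (map (\<lambda>j. x $ j) ?ys)" by simp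
  then have "sorted_wrt (\<ge>) (map (\<lambda>j. x $ j) (rev ?ys))"
    unfolding rev_map[symmetric] sorted_wrt_rev by simp
  then have "x $ (rev ?ys ! k) \<le> x $ (rev ?ys ! i)" if "i < k" "k < CARD('n)" for i k
    using sorted_wrt_nth_less[of _ "map (\<lambda>j. x $ j) (rev ?ys)" i k] that len by simp
  then have "x $ (rev ?ys ! k) \<le> x $ (rev ?ys ! i)" if "i \<le> k" "k < CARD('n)" for i k
    using that by (cases "i = k") auto
  with xs eq show ?thesis by (intro that[of "rev ?ys"]) auto
qed

lemma sum_list_take_map:
  assumes "k \<le> length js"
  shows "sum_list (take k (map f js)) = (\<Sum>i<k. f (js ! i))"
  using assms by (simp add: sum_list_sum_nth atLeast0LessThan)

text \<open>Exchange argument: let \<open>B\<close> hold the indices of the \<open>k\<close> largest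
  entries and let \<open>t\<close> be the \<open>k\<close>-th largest entry. The sets
  \<open>A - B\<close> and \<open>B - A\<close> have the same size, and \<open>t\<close> separates
  the values on them. Together with \<open>top_entries_attained\<close> this identifies the top sum
  as a maximum over \<open>k\<close>-element index sets.\<close>

lemma sum_le_top_entries:
  fixes x :: "real ^ 'n"
  shows "(\<Sum>j\<in>A. x $ j) \<le> sum_list (take (card A) (entries_decreasing x))"
proof -
  obtain js where js: "distinct js" "set js = UNIV" "entries_decreasing x = map (\<lambda>j. x $ j) js"
    "\<And>i k. i \<le> k \<Longrightarrow> k < CARD('n) \<Longrightarrow> x $ (js ! k) \<le> x $ (js ! i)"
    using entries_decreasing_enumeration by blast
  define k where "k = card A"
  have len: "length js = CARD('n)" using js distinct_card[of js] by simp
  have k: "k \<le> CARD('n)" unfolding k_def by (rule card_mono) auto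
  define B where "B = set (take k js)"
  have cB: "card B = k" using js len k by (simp add: B_def distinct_card)
  have sB: "(\<Sum>j\<in>B. x $ j) = sum_list (take k (entries_decreasing x))"
    using js by (simp add: B_def sum.distinct_set_conv_list take_map)
  show ?thesis
  proof (cases "k = 0")
    case True
    then show ?thesis by (simp add: k_def)
  next
    case False
    define t where "t = x $ (js ! (k - 1))"
    have lo: "t \<le> x $ j" if j: "j \<in> B" for j
    proof -
      obtain i where "i < k" "j = js ! i" using j len k by (auto simp: B_def in_set_conv_nth)
      then show ?thesis using js(4)[of i "k - 1"] k by (simp add: t_def)
    qed
    have hi: "x $ j \<le> t" if j: "j \<notin> B" for j
    proof -
      obtain i where i: "i < CARD('n)" "j = js ! i"
        using js(2) len by (metis UNIV_I in_set_conv_nth)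
      have "k \<le> i"
      proof (rule ccontr)
        assume "\<not> k \<le> i"
        then have "take k js ! i = j" "i < length (take k js)" using i len k by auto
        then have "j \<in> B" unfolding B_def by (metis nth_mem)
        then show False using j by simp
      qed
      then show ?thesis using js(4)[of "k - 1" i] i by (simp add: t_def)
    qed
    have "card (A \<inter> B) + card (A - B) = k" "card (A \<inter> B) + card (B - A) = k"
      using cB card_Int_Diff[of A B] card_Int_Diff[of B A] by (auto simp: k_def Int_commute)
    then have c: "card (A - B) = card (B - A)" by simp
    have "(\<Sum>j\<in>A. x $ j) = (\<Sum>j\<in>A \<inter> B. x $ j) + (\<Sum>j\<in>A - B. x $ j)"
      by (rule sum.Int_Diff) simp
    also have "(\<Sum>j\<in>A - B. x $ j) \<le> of_nat (card (A - B)) * t"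
      by (rule sum_bounded_above) (use hi in auto)
    also have "of_nat (card (A - B)) * t \<le> (\<Sum>j\<in>B - A. x $ j)"
      unfolding c by (rule sum_bounded_below) (use lo in auto)
    also have "(\<Sum>j\<in>A \<inter> B. x $ j) + (\<Sum>j\<in>B - A. x $ j) = (\<Sum>j\<in>B. x $ j)"
      by (subst sum.Int_Diff[of B _ A]) (auto simp: Int_commute)
    finally show ?thesis using sB by (simp add: k_def)
  qed
qed

lemma top_entries_attained:
  fixes x :: "real ^ 'n"
  assumes "k \<le> CARD('n)"
  obtains A where "card A = k" "sum_list (take k (entries_decreasing x)) = (\<Sum>j\<in>A. x $ j)"
proof -
  obtain js where js: "distinct js" "set js = UNIV" "entries_decreasing x = map (\<lambda>j. x $ j) js"
    by (rule entries_decreasing_enumeration)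
  have len: "length js = CARD('n)" using js distinct_card[of js] by simp
  show ?thesis
    by (rule that[of "set (take k js)"])
      (use js len assms in \<open>simp_all add: distinct_card sum.distinct_set_conv_list take_map\<close>)
qed

section \<open>Transfers between two coordinates\<close>

definition pair_update :: "real ^ 'n \<Rightarrow> 'n \<Rightarrow> 'n \<Rightarrow> real \<Rightarrow> real \<Rightarrow> real ^ 'n" where
  "pair_update y i j u v = (\<chi> l. if l = i then u else if l = j then v else y $ l)"

lemma pair_update_nth:
  "pair_update y i j u v $ l = (if l = i then u else if l = j then v else y $ l)"
  by (simp add: pair_update_def)

text \<open>Each \<open>k\<close>-element set \<open>A\<close> for the transferred vector is matched
  with a \<open>k\<close>-element set for \<open>y\<close> of at least the same sum:
  \<open>A\<close> itself, unless \<open>A\<close> contains \<open>j\<close> but not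
  \<open>i\<close>, in which case \<open>j\<close> is exchanged for \<open>i\<close>. This supplies
  the majorised pairs of the counterexamples.\<close>

lemma majorised_pair_update:
  fixes y :: "real ^ 'n"
  assumes ij: "i \<noteq> j" and uv: "y $ j \<le> v" "v \<le> u" "u \<le> y $ i" "u + v = y $ i + y $ j"
  shows "majorised (pair_update y i j u v) y"
proof -
  let ?x = "pair_update y i j u v"
  have split: "(\<Sum>l\<in>A. z $ l) = z $ i + z $ j + (\<Sum>l\<in>A - {i, j}. z $ l)" if "i \<in> A" "j \<in> A" for A and z :: "real ^ 'n"
    using that ij sum.subset_diff[of "{i, j}" A "\<lambda>l. z $ l"] by simp
  have same: "(\<Sum>l\<in>A. ?x $ l) = (\<Sum>l\<in>A. y $ l)" if "i \<notin> A" "j \<notin> A" for A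
    using that by (intro sum.cong) (auto simp: pair_update_nth)
  have both: "(\<Sum>l\<in>A. ?x $ l) = (\<Sum>l\<in>A. y $ l)" if "i \<in> A" "j \<in> A" for A
    using split[OF that, of ?x] split[OF that, of y] same[of "A - {i, j}"] ij uv
    by (simp add: pair_update_nth)
  have one: "(\<Sum>l\<in>A. z $ l) = z $ m + (\<Sum>l\<in>A - {m}. z $ l)" if "m \<in> A" for A m and z :: "real ^ 'n"
    using that by (simp add: sum.remove)
  have "sum_list (take k (entries_decreasing ?x)) \<le> sum_list (take k (entries_decreasing y))"
    if k: "k \<le> CARD('n)" for k
  proof -
    obtain A where A: "card A = k" "sum_list (take k (entries_decreasing ?x)) = (\<Sum>l\<in>A. ?x $ l)"
      using top_entries_attained[OF k, of ?x] by metis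
    have "\<exists>B. card B = k \<and> (\<Sum>l\<in>A. ?x $ l) \<le> (\<Sum>l\<in>B. y $ l)"
    proof (cases "i \<in> A")
      case True
      then show ?thesis
      proof (cases "j \<in> A")
        case False
        then have "(\<Sum>l\<in>A. ?x $ l) \<le> (\<Sum>l\<in>A. y $ l)"
          using one[OF True, of ?x] one[OF True, of y] same[of "A - {i}"] uv by (simp add: pair_update_nth)
        then show ?thesis using A by blast
      qed (use A both True in auto)
    next
      case False
      show ?thesis
      proof (cases "j \<in> A")
        case True
        let ?B = "insert i (A - {j})"
        have "(\<Sum>l\<in>A. ?x $ l) = v + (\<Sum>l\<in>A - {j}. y $ l)"
          unfolding one[OF True, of ?x] using same[of "A - {j}"] False ij by (simp add: pair_update_nth)
        also have "\<dots> \<le> y $ i + (\<Sum>l\<in>A - {j}. y $ l)" using uv by simp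
        also have "\<dots> = (\<Sum>l\<in>?B. y $ l)" using False by simp
        finally have "(\<Sum>l\<in>A. ?x $ l) \<le> (\<Sum>l\<in>?B. y $ l)" .
        moreover have "card ?B = k"
          using A(1) True False card_Suc_Diff1[of A j] by simp
        ultimately show ?thesis by blast
      qed (use A same False in auto)
    qed
    then obtain B where "card B = k" "(\<Sum>l\<in>A. ?x $ l) \<le> (\<Sum>l\<in>B. y $ l)" by blast
    then show ?thesis using A(2) sum_le_top_entries[where x = y and A = B] by simp
  qed
  then show ?thesis
    unfolding majorised_def using both[of UNIV] by simp
qed

text \<open>The Hardy-Littlewood-Polya argument, by induction on the number of coordinates where
  \<open>x\<close> and \<open>y\<close> differ. Only \<open>x\<close> has to be decreasing along
  \<open>js\<close>. Since \<open>y $ ?k < x $ ?k \<le> x $ ?j < y $ ?j\<close> at the two chosen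
  positions, the move is a genuine transfer although \<open>y\<close> may lose its order on the
  way.\<close>

lemma prefix_majorised_chain:
  fixes x y :: "real ^ 'n" and f :: "real ^ 'n \<Rightarrow> 'b" and r :: "'b \<Rightarrow> 'b \<Rightarrow> bool"
  assumes r: "reflp r" "transp r"
    and step: "\<And>y i j u v. y \<in> nonneg_orthant \<Longrightarrow> i \<noteq> j \<Longrightarrow> y $ j \<le> v \<Longrightarrow> v \<le> u \<Longrightarrow> u \<le> y $ i \<Longrightarrow>
        u + v = y $ i + y $ j \<Longrightarrow> r (f y) (f (pair_update y i j u v))"
    and js: "distinct js" "set js = UNIV"
    and x: "x \<in> nonneg_orthant" "\<And>i k. i \<le> k \<Longrightarrow> k < CARD('n) \<Longrightarrow> x $ (js ! k) \<le> x $ (js ! i)"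
    and y: "y \<in> nonneg_orthant"
    and prefix: "\<And>k. k \<le> CARD('n) \<Longrightarrow> (\<Sum>i<k. x $ (js ! i)) \<le> (\<Sum>i<k. y $ (js ! i))"
    and total: "(\<Sum>i<CARD('n). x $ (js ! i)) = (\<Sum>i<CARD('n). y $ (js ! i))"
  shows "r (f y) (f x)"
  using y prefix total
proof (induction "card {l. x $ l \<noteq> y $ l}" arbitrary: y rule: less_induct)
  case less
  define n where "n = CARD('n)"
  have len: "length js = n" using js distinct_card[of js] by (simp add: n_def)
  have onto: "\<exists>i<n. l = js ! i" for l using js(2) len in_set_conv_nth[of l js] by auto
  have inj: "js ! i = js ! k \<longleftrightarrow> i = k" if "i < n" "k < n" for i k
    using that js(1) len by (simp add: nth_eq_iff_index_eq)
  define D where "D i = y $ (js ! i) - x $ (js ! i)" for i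
  have pre: "0 \<le> (\<Sum>i<k. D i)" if "k \<le> n" for k
    using less.prems(2)[of k] that by (simp add: D_def sum_subtractf n_def)
  have tot: "(\<Sum>i<n. D i) = 0"
    using less.prems(3) by (simp add: D_def sum_subtractf n_def)
  show ?case
  proof (cases "y = x")
    case True
    then show ?thesis using r by (simp add: reflpD)
  next
    case False
    have "\<exists>k. k < n \<and> D k < 0"
    proof (rule ccontr)
      assume "\<not> (\<exists>k. k < n \<and> D k < 0)"
      then have "\<forall>k\<in>{..<n}. 0 \<le> D k" by (meson lessThan_iff not_less)
      then have "\<forall>k\<in>{..<n}. D k = 0"
        using tot sum_nonneg_eq_0_iff[of "{..<n}" D] by blast
      then have "y $ l = x $ l" for l using onto[of l] by (auto simp: D_def)
      then show False using False by (simp add: vec_eq_iff)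
    qed
    \<comment> \<open>\<open>k\<close> is the first deficit of \<open>y\<close>. Prefix sums of
      \<open>D\<close> are nonnegative, so some earlier position \<open>j\<close> has a
      surplus.\<close>
    then obtain k where k: "k < n" "D k < 0" and least: "\<forall>i<k. \<not> (i < n \<and> D i < 0)"
      unfolding exists_least_iff[of "\<lambda>k. k < n \<and> D k < 0"] by blast
    have first: "0 \<le> D i" if "i < k" for i
      using least that k(1) by (meson less_trans not_less)
    have "\<exists>j<k. 0 < D j"
    proof (rule ccontr)
      assume "\<not> (\<exists>j<k. 0 < D j)"
      then have "(\<Sum>i<k. D i) \<le> 0" by (intro sum_nonpos) (meson lessThan_iff not_less)
      then show False using pre[of "Suc k"] k by simp
    qed
    then obtain j where j: "j < k" "0 < D j" by blast
    \<comment> \<open>The largest amount that can be moved without overshooting either target; it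
      makes \<open>y\<close> agree with \<open>x\<close> at one of the two positions, so the
      induction measure drops.\<close>
    define d where "d = min (D j) (- D k)"
    have d: "0 < d" "d \<le> D j" "d \<le> - D k" "d = D j \<or> d = - D k" using j k by (auto simp: d_def)
    let ?j = "js ! j" and ?k = "js ! k"
    have jk: "?j \<noteq> ?k" using inj j k by simp
    have xjk: "x $ ?k \<le> x $ ?j" using x(2)[of j k] j k by (simp add: n_def)
    define z where "z = pair_update y ?j ?k (y $ ?j - d) (y $ ?k + d)"
    have z_nth: "z $ (js ! i) = y $ (js ! i) - (if i = j then d else 0) + (if i = k then d else 0)" if "i < n" for i
      using that inj[of i j] inj[of i k] j k by (auto simp: z_def pair_update_nth)
    have "r (f y) (f z)"
      unfolding z_def using xjk d jk less.prems(1)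
      by (intro step) (auto simp: D_def)
    moreover have "r (f z) (f x)"
    proof (rule less.hyps)
      have sub: "{l. x $ l \<noteq> z $ l} \<subseteq> {l. x $ l \<noteq> y $ l}"
        using j k by (auto simp: z_def pair_update_nth D_def)
      moreover have "\<exists>l. x $ l \<noteq> y $ l \<and> x $ l = z $ l"
        using d(4)
      proof
        assume "d = D j"
        then show ?thesis
          using z_nth[of j] j k by (intro exI[of _ ?j]) (simp add: D_def)
      next
        assume "d = - D k"
        then show ?thesis
          using z_nth[of k] j k by (intro exI[of _ ?k]) (simp add: D_def)
      qed
      ultimately show "card {l. x $ l \<noteq> z $ l} < card {l. x $ l \<noteq> y $ l}"
        by (intro psubset_card_mono) auto
      show "z \<in> nonneg_orthant"
        unfolding nonneg_orthant_def
      proof (intro CollectI allI)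
        fix l
        have nn: "0 \<le> y $ l" "0 \<le> x $ l"
          using less.prems(1) x(1) by (auto simp: nonneg_orthant_def)
        consider "l = ?j" | "l = ?k" | "l \<noteq> ?j" "l \<noteq> ?k" by blast
        then show "0 \<le> z $ l"
          by cases (use nn d jk in \<open>auto simp: z_def pair_update_nth D_def\<close>)
      qed
      have zsum: "(\<Sum>i<m. z $ (js ! i)) = (\<Sum>i<m. y $ (js ! i)) - (if j < m then d else 0) + (if k < m then d else 0)"
        if "m \<le> n" for m
      proof -
        have "(\<Sum>i<m. z $ (js ! i)) = (\<Sum>i<m. y $ (js ! i) - (if i = j then d else 0) + (if i = k then d else 0))"
          using that by (intro sum.cong) (auto simp: z_nth)
        then show ?thesis by (simp add: sum.distrib sum_subtractf)
      qed
      \<comment> \<open>Only prefixes that contain \<open>j\<close> but not \<open>k\<close> lose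
        \<open>d\<close>. All their differences are nonnegative because \<open>k\<close> is the
        first deficit, so their total is at least \<open>D j\<close>, which is at least
        \<open>d\<close>.\<close>
      show "(\<Sum>i<m. x $ (js ! i)) \<le> (\<Sum>i<m. z $ (js ! i))" if "m \<le> CARD('n)" for m
      proof (cases "j < m \<and> m \<le> k")
        case True
        have "(\<Sum>i\<in>{j}. D i) \<le> (\<Sum>i<m. D i)"
          by (rule sum_mono2) (use True first in auto)
        then have "d \<le> (\<Sum>i<m. y $ (js ! i)) - (\<Sum>i<m. x $ (js ! i))"
          using d(2) by (simp add: D_def sum_subtractf)
        then show ?thesis using zsum[of m] True that by (simp add: n_def)
      next
        case False
        then have "(\<Sum>i<m. z $ (js ! i)) = (\<Sum>i<m. y $ (js ! i))"
          using zsum[of m] that j by (auto simp: n_def)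
        then show ?thesis using less.prems(2)[OF that] by simp
      qed
      show "(\<Sum>i<CARD('n). x $ (js ! i)) = (\<Sum>i<CARD('n). z $ (js ! i))"
        using zsum[of n] less.prems(3) j k by (simp add: n_def)
    qed
    ultimately show ?thesis using r(2) by (blast dest: transpD)
  qed
qed

text \<open>Permutation invariance of \<open>f\<close> allows \<open>y\<close> to be rearranged so
  that both vectors decrease along one enumeration; majorisation then is prefix domination. The
  abstract relation \<open>r\<close> stands for either direction of the order, so the convex and the
  concave case share this proof.\<close>

lemma majorised_chain:
  fixes x y :: "real ^ 'n" and f :: "real ^ 'n \<Rightarrow> 'b" and r :: "'b \<Rightarrow> 'b \<Rightarrow> bool"
  assumes r: "reflp r" "transp r"
    and step: "\<And>y i j u v. y \<in> nonneg_orthant \<Longrightarrow> i \<noteq> j \<Longrightarrow> y $ j \<le> v \<Longrightarrow> v \<le> u \<Longrightarrow> u \<le> y $ i \<Longrightarrow>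
        u + v = y $ i + y $ j \<Longrightarrow> r (f y) (f (pair_update y i j u v))"
    and perm: "\<And>y \<pi>. bij \<pi> \<Longrightarrow> f (\<chi> l. y $ \<pi> l) = f y"
    and xy: "x \<in> nonneg_orthant" "y \<in> nonneg_orthant" "majorised x y"
  shows "r (f y) (f x)"
proof -
  obtain js where js: "distinct js" "set js = UNIV" "entries_decreasing x = map (\<lambda>j. x $ j) js"
    "\<And>i k. i \<le> k \<Longrightarrow> k < CARD('n) \<Longrightarrow> x $ (js ! k) \<le> x $ (js ! i)"
    using entries_decreasing_enumeration by blast
  obtain ks where ks: "distinct ks" "set ks = UNIV" "entries_decreasing y = map (\<lambda>j. y $ j) ks"
    by (rule entries_decreasing_enumeration)
  have len: "length js = CARD('n)" "length ks = CARD('n)"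
    using js ks distinct_card[of js] distinct_card[of ks] by simp_all
  have bj: "bij_betw ((!) js) {..<CARD('n)} UNIV" and bk: "bij_betw ((!) ks) {..<CARD('n)} UNIV"
    using js ks len by (auto intro: bij_betw_nth)
  \<comment> \<open>\<open>\<pi>\<close> sends the index of the \<open>i\<close>-th largest entry of
    \<open>x\<close> to that of the \<open>i\<close>-th largest entry of \<open>y\<close>.\<close>
  define \<pi> where "\<pi> l = ks ! inv_into {..<CARD('n)} ((!) js) l" for l
  have "bij \<pi>"
    using bij_betw_trans[OF bij_betw_inv_into[OF bj] bk] by (simp add: \<pi>_def[abs_def] comp_def)
  have \<pi>: "\<pi> (js ! i) = ks ! i" if "i < CARD('n)" for i
    using that bj by (simp add: \<pi>_def bij_betw_def inv_into_f_f)
  define y' where "y' = (\<chi> l. y $ \<pi> l)"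
  have sums: "(\<Sum>i<k. x $ (js ! i)) = sum_list (take k (entries_decreasing x))"
      "(\<Sum>i<k. y' $ (js ! i)) = sum_list (take k (entries_decreasing y))" if "k \<le> CARD('n)" for k
    using that js ks len by (auto simp: sum_list_take_map y'_def \<pi> simp del: take_map)
  have maj: "(\<Sum>i<k. x $ (js ! i)) \<le> (\<Sum>i<k. y' $ (js ! i))" if "k \<le> CARD('n)" for k
    using that xy(3) by (cases "k = 0") (auto simp: sums majorised_def)
  have total: "(\<Sum>i<CARD('n). x $ (js ! i)) = (\<Sum>i<CARD('n). y' $ (js ! i))"
  proof -
    have "(\<Sum>i<CARD('n). x $ (js ! i)) = (\<Sum>l\<in>UNIV. x $ l)"
      by (rule sum.reindex_bij_betw[OF bj])
    also have "\<dots> = (\<Sum>l\<in>UNIV. y $ l)" using xy(3) by (simp add: majorised_def)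
    also have "\<dots> = (\<Sum>i<CARD('n). y $ (ks ! i))"
      by (rule sum.reindex_bij_betw[OF bk, symmetric])
    also have "\<dots> = (\<Sum>i<CARD('n). y' $ (js ! i))" by (simp add: y'_def \<pi>)
    finally show ?thesis .
  qed
  have "r (f y') (f x)"
  proof (rule prefix_majorised_chain[OF r _ js(1,2) xy(1) js(4) _ maj total])
    show "y' \<in> nonneg_orthant" using xy(2) by (simp add: nonneg_orthant_def y'_def)
  qed (fact step)
  then show ?thesis using perm[OF \<open>bij \<pi>\<close>, of y] by (simp add: y'_def)
qed

subsection \<open>Densities whose difference changes sign twice\<close>

text \<open>Every case is the three-point inequality of convexity, cleared of denominators, with
  \<open>u\<close> as the middle, the first or the last point.\<close>

lemma convex_chord:
  fixes g :: "real \<Rightarrow> real"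
  assumes g: "convex_on {0<..} g" and u: "0 < u1" "u1 < u2"
  defines "k \<equiv> (g u2 - g u1) / (u2 - u1)"
  shows "\<And>u. u1 \<le> u \<Longrightarrow> u \<le> u2 \<Longrightarrow> g u \<le> g u1 + k * (u - u1)"
    and "\<And>u. 0 < u \<Longrightarrow> u \<le> u1 \<or> u2 \<le> u \<Longrightarrow> g u1 + k * (u - u1) \<le> g u"
proof -
  have three: "(z - x) * g y \<le> (z - y) * g x + (y - x) * g z"
    if "0 < x" "x \<le> y" "y \<le> z" "x < z" for x y z
  proof -
    have "g ((1 - (y - x) / (z - x)) *\<^sub>R x + ((y - x) / (z - x)) *\<^sub>R z)
        \<le> (1 - (y - x) / (z - x)) * g x + ((y - x) / (z - x)) * g z"
      by (rule convex_onD[OF g]) (use that in \<open>auto simp: field_simps\<close>)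
    also have "(1 - (y - x) / (z - x)) *\<^sub>R x + ((y - x) / (z - x)) *\<^sub>R z
        = x + (y - x) / (z - x) * (z - x)"
      unfolding real_scaleR_def by algebra
    also have "\<dots> = y"
      using that by simp
    also have "(1 - (y - x) / (z - x)) * g x + ((y - x) / (z - x)) * g z
        = ((z - y) * g x + (y - x) * g z) / (z - x)"
      using that by (simp add: divide_simps) (simp add: algebra_simps)?
    finally show ?thesis
      using that by (simp add: pos_le_divide_eq mult.commute)
  qed
  have eq: "(u2 - u1) * (g u1 + k * (u - u1)) = (u2 - u) * g u1 + (u - u1) * g u2" for u
    using u by (simp add: k_def divide_simps) (simp add: algebra_simps)?
  show "g u \<le> g u1 + k * (u - u1)" if "u1 \<le> u" "u \<le> u2" for u
  proof -
    have "(u2 - u1) * g u \<le> (u2 - u1) * (g u1 + k * (u - u1))"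
      unfolding eq using three[of u1 u u2] u that by simp
    then show ?thesis using u by simp
  qed
  show "g u1 + k * (u - u1) \<le> g u" if "0 < u" "u \<le> u1 \<or> u2 \<le> u" for u
  proof -
    have "(u2 - u1) * (g u1 + k * (u - u1)) \<le> (u2 - u1) * g u"
      using that(2)
    proof
      assume "u \<le> u1"
      then show ?thesis unfolding eq using three[of u u1 u2] u that by (simp add: algebra_simps)
    next
      assume "u2 \<le> u"
      then show ?thesis unfolding eq using three[of u1 u2 u] u that by (simp add: algebra_simps)
    qed
    then show ?thesis using u by simp
  qed
qed

section \<open>Chords of powers in the variable \<open>z ^ 4\<close>\<close>

lemma convex_on_powr_nonpos:
  assumes "r \<le> 0" shows "convex_on {0<..} (\<lambda>x::real. x powr r)"
  by (rule f''_ge0_imp_convex[where f' = "\<lambda>x. r * x powr (r - 1)"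
        and f'' = "\<lambda>x. r * ((r - 1) * x powr (r - 1 - 1))"])
    (use assms in \<open>auto intro!: derivative_eq_intros mult_nonpos_nonpos mult_nonpos_nonneg\<close>)

lemma convex_on_minus_powr:
  assumes "0 \<le> r" "r \<le> 1" shows "convex_on {0<..} (\<lambda>x::real. - (x powr r))"
  by (rule f''_ge0_imp_convex[where f' = "\<lambda>x. - (r * x powr (r - 1))"
        and f'' = "\<lambda>x. - (r * ((r - 1) * x powr (r - 1 - 1)))"])
    (use assms in \<open>auto intro!: derivative_eq_intros mult_nonneg_nonpos[of r] mult_nonpos_nonneg[of "r - 1"]\<close>)

text \<open>In the variable \<open>z ^ 4\<close> the power is the concave function with exponent
  \<open>p / 4\<close>, and \<alpha> and \<open>B\<close> are the intercept and slope of its chord.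
  Their signs matter because the later comparison takes place in [0, \<infinity>], where only
  nonnegative multiples can be integrated separately.\<close>

lemma powr_chord_pos:
  fixes x y p :: real
  assumes p: "0 < p" "p < 4" and xy: "0 < x" "x < y"
  obtains \<alpha> B where "0 \<le> \<alpha>" "0 \<le> B"
    "\<And>z. x \<le> z \<Longrightarrow> z \<le> y \<Longrightarrow> \<alpha> + B * z ^ 4 \<le> z powr p"
    "\<And>z. 0 < z \<Longrightarrow> z \<le> x \<or> y \<le> z \<Longrightarrow> z powr p \<le> \<alpha> + B * z ^ 4"
proof -
  define B where "B = (y powr p - x powr p) / (y ^ 4 - x ^ 4)"
  have xy4: "x ^ 4 < y ^ 4" using xy by (simp add: power_strict_mono)
  have pw: "(z ^ 4) powr (p / 4) = z powr p" if "0 < z" for z :: real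
  proof -
    have "z ^ 4 = z powr 4" using that by simp
    then show ?thesis by (simp add: powr_powr del: powr_numeral)
  qed
  note ch = convex_chord[OF convex_on_minus_powr[of "p / 4"], of "x ^ 4" "y ^ 4"]
  have k: "(- ((y ^ 4) powr (p / 4)) - - ((x ^ 4) powr (p / 4))) / (y ^ 4 - x ^ 4) = - B"
    using xy unfolding B_def by (simp add: pw) (metis minus_diff_eq minus_divide_left)
  show ?thesis
  proof (rule that[of "x powr p - B * x ^ 4" B])
    show "0 \<le> B" using xy xy4 p by (simp add: B_def powr_mono2)
    \<comment> \<open>The intercept is nonnegative because the ratio of \<open>z powr p\<close> to
      \<open>z ^ 4\<close> decreases in \<open>z\<close>.\<close>
    have "y powr (p - 4) \<le> x powr (p - 4)" using xy p by (intro powr_mono2') auto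
    then have "y powr p / y ^ 4 \<le> x powr p / x ^ 4" using xy by (simp add: powr_diff)
    then have "y powr p * x ^ 4 \<le> x powr p * y ^ 4" using xy by (simp add: divide_simps mult.commute)
    then have "B * x ^ 4 \<le> x powr p"
      using xy4 by (simp add: B_def pos_divide_le_eq algebra_simps)
    then show "0 \<le> x powr p - B * x ^ 4" by simp
    show "x powr p - B * x ^ 4 + B * z ^ 4 \<le> z powr p" if "x \<le> z" "z \<le> y" for z
      using ch(1)[of "z ^ 4"] p xy xy4 that unfolding k
      by (simp add: pw power_mono algebra_simps)
    show "z powr p \<le> x powr p - B * x ^ 4 + B * z ^ 4" if "0 < z" "z \<le> x \<or> y \<le> z" for z
      using ch(2)[of "z ^ 4"] p xy xy4 that unfolding k
      by (auto simp add: pw power_mono algebra_simps)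
  qed
qed

text \<open>For negative \<open>p\<close> the power is convex and decreasing in
  \<open>z ^ 4\<close>. The slope of the chord is therefore written as \<open>- B\<close>, and its
  intercept is nonnegative at once.\<close>

lemma powr_chord_neg:
  fixes x y p :: real
  assumes p: "p < 0" and xy: "0 < x" "x < y"
  obtains \<alpha> B where "0 \<le> \<alpha>" "0 \<le> B"
    "\<And>z. x \<le> z \<Longrightarrow> z \<le> y \<Longrightarrow> z powr p \<le> \<alpha> - B * z ^ 4"
    "\<And>z. 0 < z \<Longrightarrow> z \<le> x \<or> y \<le> z \<Longrightarrow> \<alpha> - B * z ^ 4 \<le> z powr p"
proof -
  define B where "B = (x powr p - y powr p) / (y ^ 4 - x ^ 4)"
  have xy4: "x ^ 4 < y ^ 4" using xy by (simp add: power_strict_mono)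
  have pw: "(z ^ 4) powr (p / 4) = z powr p" if "0 < z" for z :: real
  proof -
    have "z ^ 4 = z powr 4" using that by simp
    then show ?thesis by (simp add: powr_powr del: powr_numeral)
  qed
  note ch = convex_chord[OF convex_on_powr_nonpos[of "p / 4"], of "x ^ 4" "y ^ 4"]
  have k: "((y ^ 4) powr (p / 4) - (x ^ 4) powr (p / 4)) / (y ^ 4 - x ^ 4) = - B"
    using xy by (simp add: pw B_def minus_divide_left)
  have B: "0 \<le> B" using xy xy4 p by (simp add: B_def powr_mono2')
  show ?thesis
  proof (rule that[of "x powr p + B * x ^ 4" B])
    show "0 \<le> B" by fact
    show "0 \<le> x powr p + B * x ^ 4" using B xy by simp
    show "z powr p \<le> x powr p + B * x ^ 4 - B * z ^ 4" if "x \<le> z" "z \<le> y" for z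
      using ch(1)[of "z ^ 4"] p xy xy4 that unfolding k
      by (simp add: pw power_mono algebra_simps)
    show "x powr p + B * x ^ 4 - B * z ^ 4 \<le> z powr p" if "0 < z" "z \<le> x \<or> y \<le> z" for z
      using ch(2)[of "z ^ 4"] p xy xy4 that unfolding k
      by (auto simp add: pw power_mono algebra_simps)
  qed
qed

text \<open>Integrates the pointwise inequality with every term on the side where its coefficient is
  nonnegative. Equal masses balance the \<alpha> terms, the moment inequality replaces
  \<open>h0\<close> by \<open>h1\<close>, and the common summand \<open>?C\<close> is finite and
  cancels, even if the integrals of \<open>f\<close> are infinite. Taking \<open>ha\<close>,
  \<open>hb\<close> to be \<open>h0\<close>, \<open>h1\<close> in either order serves both signs of
  the exponent.\<close>

lemma weighted_nn_integral_le:
  fixes f u ha hb h0 h1 :: "real \<Rightarrow> real"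
  assumes [measurable]: "f \<in> borel_measurable borel" "u \<in> borel_measurable borel"
      "ha \<in> borel_measurable borel" "hb \<in> borel_measurable borel"
      "h0 \<in> borel_measurable borel" "h1 \<in> borel_measurable borel"
    and nonneg: "\<And>t. 0 \<le> f t * ha t" "\<And>t. 0 \<le> f t * hb t" "\<And>t. 0 \<le> u t * h0 t" "\<And>t. 0 \<le> u t * h1 t"
      "\<And>t. 0 \<le> ha t" "\<And>t. 0 \<le> hb t"
    and prob: "(\<integral>\<^sup>+t. ha t \<partial>lborel) = 1" "(\<integral>\<^sup>+t. hb t \<partial>lborel) = 1"
    and mom: "(\<integral>\<^sup>+t. u t * h0 t \<partial>lborel) \<le> (\<integral>\<^sup>+t. u t * h1 t \<partial>lborel)"
      "(\<integral>\<^sup>+t. u t * h1 t \<partial>lborel) < \<infinity>"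
    and coef: "0 \<le> \<alpha>" "0 \<le> B"
    and le: "\<And>t. f t * ha t + \<alpha> * hb t + B * (u t * h1 t) \<le> f t * hb t + \<alpha> * ha t + B * (u t * h0 t)"
  shows "(\<integral>\<^sup>+t. f t * ha t \<partial>lborel) \<le> (\<integral>\<^sup>+t. f t * hb t \<partial>lborel)"
proof -
  have split: "(\<integral>\<^sup>+t. ennreal (f t * g t + \<alpha> * g' t + B * (u t * h t)) \<partial>lborel)
      = (\<integral>\<^sup>+t. f t * g t \<partial>lborel) + (ennreal \<alpha> * (\<integral>\<^sup>+t. g' t \<partial>lborel)
        + ennreal B * (\<integral>\<^sup>+t. u t * h t \<partial>lborel))"
    if [measurable]: "g \<in> borel_measurable borel" "g' \<in> borel_measurable borel" "h \<in> borel_measurable borel"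
      and nn: "\<And>t. 0 \<le> f t * g t" "\<And>t. 0 \<le> g' t" "\<And>t. 0 \<le> u t * h t" for g g' h
  proof -
    have "(\<integral>\<^sup>+t. ennreal (f t * g t + \<alpha> * g' t + B * (u t * h t)) \<partial>lborel)
      = (\<integral>\<^sup>+t. ennreal (f t * g t) + (ennreal \<alpha> * ennreal (g' t) + ennreal B * ennreal (u t * h t)) \<partial>lborel)"
      using coef nn by (intro nn_integral_cong)
        (simp add: ennreal_plus[symmetric] ennreal_mult[symmetric] del: ennreal_plus)
    then show ?thesis by (simp add: nn_integral_add nn_integral_cmult)
  qed
  let ?C = "ennreal \<alpha> + ennreal B * (\<integral>\<^sup>+t. u t * h1 t \<partial>lborel)"
  have "(\<integral>\<^sup>+t. f t * ha t \<partial>lborel) + ?C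
      \<le> (\<integral>\<^sup>+t. f t * hb t \<partial>lborel) + (ennreal \<alpha> + ennreal B * (\<integral>\<^sup>+t. u t * h0 t \<partial>lborel))"
    using nn_integral_mono[of lborel "\<lambda>t. ennreal (f t * ha t + \<alpha> * hb t + B * (u t * h1 t))"
        "\<lambda>t. ennreal (f t * hb t + \<alpha> * ha t + B * (u t * h0 t))"] le nonneg
    by (simp add: split prob ennreal_leI)
  also have "\<dots> \<le> (\<integral>\<^sup>+t. f t * hb t \<partial>lborel) + ?C"
    using mom(1) by (intro add_left_mono mult_left_mono) auto
  finally show ?thesis
    using mom(2) by (auto simp: ennreal_add_left_cancel_le ennreal_mult_eq_top_iff
        add.commute[of _ ?C])
qed

text \<open>As the masses agree, subtracting the constant \<open>c\<close> from \<open>u\<close>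
  does not change the difference of the two integrals, and it makes the integrand nonpositive off
  the null set containing \<open>t0\<close>, where the sign may be unknown. This rules out the
  degenerate sign patterns in \<open>two_crossings\<close>.\<close>

lemma single_crossing_moment_le:
  fixes h0 h1 :: "real \<Rightarrow> real"
  assumes [measurable]: "u \<in> borel_measurable borel"
      "h0 \<in> borel_measurable borel" "h1 \<in> borel_measurable borel"
    and h0: "\<And>t. 0 \<le> h0 t" "\<And>t. t \<le> 0 \<Longrightarrow> h0 t = 0" "(\<integral>\<^sup>+t. h0 t \<partial>lborel) = 1"
    and h1: "\<And>t. 0 \<le> h1 t" "\<And>t. t \<le> 0 \<Longrightarrow> h1 t = 0" "(\<integral>\<^sup>+t. h1 t \<partial>lborel) = 1"
    and u: "\<And>t. 0 < t \<Longrightarrow> 0 \<le> u t"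
    and c: "0 \<le> (c::real)"
    and le: "\<And>t. 0 < t \<Longrightarrow> t \<noteq> t0 \<Longrightarrow> (u t - c) * (h1 t - h0 t) \<le> 0"
  shows "(\<integral>\<^sup>+t. u t * h1 t \<partial>lborel) \<le> (\<integral>\<^sup>+t. u t * h0 t \<partial>lborel)"
proof -
  have nn: "0 \<le> u t * h1 t" "0 \<le> u t * h0 t" for t
    using u[of t] h0(1,2)[of t] h1(1,2)[of t] by (cases "0 < t"; simp)+
  have le': "u t * h1 t + c * h0 t \<le> u t * h0 t + c * h1 t" if "t \<noteq> t0" for t
    using le[of t] that h0(2)[of t] h1(2)[of t] by (cases "0 < t") (auto simp: algebra_simps)
  have split: "(\<integral>\<^sup>+t. ennreal (u t * g t + c * g' t) \<partial>lborel)
      = (\<integral>\<^sup>+t. u t * g t \<partial>lborel) + ennreal c * (\<integral>\<^sup>+t. g' t \<partial>lborel)"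
    if [measurable]: "g \<in> borel_measurable borel" "g' \<in> borel_measurable borel"
      and "\<And>t. 0 \<le> u t * g t" "\<And>t. 0 \<le> g' t" for g g'
  proof -
    have "(\<integral>\<^sup>+t. ennreal (u t * g t + c * g' t) \<partial>lborel)
        = (\<integral>\<^sup>+t. ennreal (u t * g t) + ennreal c * ennreal (g' t) \<partial>lborel)"
      using that c by (intro nn_integral_cong)
        (simp add: ennreal_plus[symmetric] ennreal_mult[symmetric] del: ennreal_plus)
    then show ?thesis by (simp add: nn_integral_add nn_integral_cmult)
  qed
  have "(\<integral>\<^sup>+t. ennreal (u t * h1 t + c * h0 t) \<partial>lborel) \<le> (\<integral>\<^sup>+t. ennreal (u t * h0 t + c * h1 t) \<partial>lborel)"
    by (rule nn_integral_mono_AE, rule eventually_mono[OF AE_lborel_singleton[where c = t0]])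
      (intro ennreal_leI le')
  then show ?thesis
    using nn h0 h1 by (simp add: split add.commute[of _ "ennreal c"] ennreal_add_left_cancel_le)
qed

text \<open>The set \<open>I\<close> where \<open>h1\<close> dominates is an interval. The strict
  fourth-moment inequality forces it to be nonempty, to start at a positive point and to have more
  than one point. Its endpoints, shifted by \<open>s\<close>, are then the nodes of the chord; if it
  is unbounded, a constant replaces the chord.\<close>

lemma two_crossings:
  fixes h0 h1 :: "real \<Rightarrow> real" and p s :: real
  assumes meas [measurable]: "h0 \<in> borel_measurable borel" "h1 \<in> borel_measurable borel"
    and h0: "\<And>t. 0 \<le> h0 t" "\<And>t. t \<le> 0 \<Longrightarrow> h0 t = 0" "(\<integral>\<^sup>+t. h0 t \<partial>lborel) = 1"
    and h1: "\<And>t. 0 \<le> h1 t" "\<And>t. t \<le> 0 \<Longrightarrow> h1 t = 0" "(\<integral>\<^sup>+t. h1 t \<partial>lborel) = 1"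
    and conv: "convex {t. 0 < t \<and> h0 t \<le> h1 t}"
    and s: "0 \<le> s"
    and mom: "(\<integral>\<^sup>+t. (t + s) ^ 4 * h0 t \<partial>lborel) < (\<integral>\<^sup>+t. (t + s) ^ 4 * h1 t \<partial>lborel)"
      "(\<integral>\<^sup>+t. (t + s) ^ 4 * h1 t \<partial>lborel) < \<infinity>"
  shows "0 < p \<Longrightarrow> p < 4 \<Longrightarrow> (\<integral>\<^sup>+t. (t + s) powr p * h0 t \<partial>lborel) \<le> (\<integral>\<^sup>+t. (t + s) powr p * h1 t \<partial>lborel)"
    and "p < 0 \<Longrightarrow> (\<integral>\<^sup>+t. (t + s) powr p * h1 t \<partial>lborel) \<le> (\<integral>\<^sup>+t. (t + s) powr p * h0 t \<partial>lborel)"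
proof -
  define I where "I = {t. 0 < t \<and> h0 t \<le> h1 t}"
  have I_interval: "t \<in> I" if "x \<in> I" "y \<in> I" "x \<le> t" "t \<le> y" for x y t
    using conv that unfolding I_def[symmetric] is_interval_convex_1[symmetric] is_interval_1 by blast
  have I_pos: "0 < t" "h0 t \<le> h1 t" if "t \<in> I" for t using that by (auto simp: I_def)
  have not_I: "h1 t \<le> h0 t" if "0 < t" "t \<notin> I" for t using that by (auto simp: I_def)
  have bdd: "bdd_below I" by (rule bdd_belowI[of _ 0]) (auto simp: I_def)
  \<comment> \<open>A difference whose sign is opposite to that of an increasing fourth power minus
    a constant would contradict the strict moment inequality.\<close>
  have absurd: False if "0 \<le> c" "\<And>t. 0 < t \<Longrightarrow> t \<noteq> t0 \<Longrightarrow> ((t + s) ^ 4 - c) * (h1 t - h0 t) \<le> 0" for c t0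
    using single_crossing_moment_le[of "\<lambda>t. (t + s) ^ 4" h0 h1 c t0] h0 h1 s that mom(1)
    by (simp add: not_le[symmetric])
  \<comment> \<open>Otherwise \<open>h1 \<le> h0\<close> on the positive half-line, and the constant
    0 yields the contradiction.\<close>
  have ne: "I \<noteq> {}"
  proof
    assume "I = {}"
    then show False
      using not_I s by (intro absurd[of 0 0]) (auto intro!: mult_nonneg_nonpos)
  qed
  define x where "x = Inf I"
  have x0: "0 \<le> x" unfolding x_def using ne I_pos(1) by (intro cInf_greatest) (auto intro: less_imp_le)
  have below: "h1 t \<le> h0 t" if "0 < t" "t < x" for t
    using that cInf_lower[OF _ bdd, of t] not_I by (force simp: x_def)
  have above: "\<exists>z\<in>I. z < t" if "x < t" for t
    using that cInf_less_iff[OF ne bdd, of t] by (simp add: x_def)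
  have mono4: "(t + s) ^ 4 \<le> (z + s) ^ 4" if "0 < t" "t \<le> z" for t z
    using that s by (intro power_mono) auto
  \<comment> \<open>If \<open>I\<close> reached down to 0, there would be at most one sign change,
    from plus to minus, at \<open>Sup I\<close>; the constant to subtract is the fourth power at
    that point.\<close>
  have xpos: "0 < x"
  proof (rule ccontr)
    assume "\<not> 0 < x"
    then have x: "x = 0" using x0 by simp
    show False
    proof (cases "bdd_above I")
      case True
      define y where "y = Sup I"
      have up: "h1 t \<le> h0 t" if "0 < t" "y < t" for t
        using that cSup_upper[OF _ True, of t] not_I by (force simp: y_def)
      have inside: "h0 t \<le> h1 t" if t: "0 < t" "t < y" for t
      proof -
        obtain z where "z \<in> I" "t < z" using less_cSup_iff[OF ne True] t by (auto simp: y_def)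
        moreover obtain w where "w \<in> I" "w < t" using above[of t] t x by auto
        ultimately show ?thesis using I_interval[of w z t] I_pos by auto
      qed
      have "0 \<le> y" using I_pos(1) ne cSup_upper[OF _ True] unfolding y_def
        by (metis ex_in_conv less_imp_le order_trans)
      show False
      proof (rule absurd[of "(y + s) ^ 4" y])
        fix t assume t: "0 < t" "t \<noteq> y"
        show "((t + s) ^ 4 - (y + s) ^ 4) * (h1 t - h0 t) \<le> 0"
        proof (cases "t < y")
          case True
          then show ?thesis using mono4[of t y] inside[of t] t by (intro mult_nonpos_nonneg) auto
        next
          case False
          then show ?thesis using mono4[of y t] up[of t] t s \<open>0 \<le> y\<close>
            by (intro mult_nonneg_nonpos) (auto intro: power_mono)
        qed
      qed simp
    next
      case False
      \<comment> \<open>Without an upper endpoint \<open>h1\<close> dominates everywhere; equal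
        masses then make the densities agree almost everywhere, which contradicts the strict
        inequality.\<close>
      have all: "h0 t \<le> h1 t" if t: "0 < t" for t
      proof -
        obtain z where "z \<in> I" "t < z" using False by (auto simp: bdd_above_def not_le)
        moreover obtain w where "w \<in> I" "w < t" using above[of t] t x by auto
        ultimately show ?thesis using I_interval[of w z t] I_pos by auto
      qed
      then have all: "h0 t \<le> h1 t" for t using h0(2)[of t] h1(1)[of t] by (cases "0 < t") auto
      have "(\<integral>\<^sup>+t. ennreal (h1 t) - ennreal (h0 t) \<partial>lborel) = 0"
        using all h0 h1 by (subst nn_integral_diff) (auto intro!: ennreal_leI)
      then have "AE t in lborel. ennreal (h1 t) - ennreal (h0 t) = 0"
        by (subst (asm) nn_integral_0_iff_AE) auto
      then have "AE t in lborel. h1 t = h0 t"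
      proof eventually_elim
        case (elim t)
        then show ?case using all[of t] h0(1)[of t] h1(1)[of t]
          by (simp add: ennreal_minus ennreal_eq_0_iff)
      qed
      then have "(\<integral>\<^sup>+t. (t + s) ^ 4 * h1 t \<partial>lborel) = (\<integral>\<^sup>+t. (t + s) ^ 4 * h0 t \<partial>lborel)"
        by (intro nn_integral_cong_AE) auto
      then show False using mom(1) by simp
    qed
  qed
  have nn: "0 \<le> (t + s) powr p * h0 t" "0 \<le> (t + s) powr p * h1 t"
      "0 \<le> (t + s) ^ 4 * h0 t" "0 \<le> (t + s) ^ 4 * h1 t" for t
    using h0(1) h1(1) by auto
  \<comment> \<open>It now suffices to find nonnegative \<alpha> and \<open>B\<close> that give the
    integrand one sign. \<open>neg\<close> is the counterpart with slope \<open>- B\<close> and the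
    inequality reversed.\<close>
  have pos: "(\<integral>\<^sup>+t. (t + s) powr p * h0 t \<partial>lborel) \<le> (\<integral>\<^sup>+t. (t + s) powr p * h1 t \<partial>lborel)"
    if "0 \<le> \<alpha>" "0 \<le> B" "\<And>t. 0 < t \<Longrightarrow> 0 \<le> ((t + s) powr p - \<alpha> - B * (t + s) ^ 4) * (h1 t - h0 t)" for \<alpha> B
  proof (rule weighted_nn_integral_le[where u = "\<lambda>t. (t + s) ^ 4" and ?h0.0 = h0 and ?h1.0 = h1 and \<alpha> = \<alpha> and B = B])
    fix t
    show "(t + s) powr p * h0 t + \<alpha> * h1 t + B * ((t + s) ^ 4 * h1 t)
        \<le> (t + s) powr p * h1 t + \<alpha> * h0 t + B * ((t + s) ^ 4 * h0 t)"
      using that(3)[of t] h0(2)[of t] h1(2)[of t] by (cases "0 < t") (auto simp: algebra_simps)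
  qed (use nn h0 h1 mom that in auto)
  have neg: "(\<integral>\<^sup>+t. (t + s) powr p * h1 t \<partial>lborel) \<le> (\<integral>\<^sup>+t. (t + s) powr p * h0 t \<partial>lborel)"
    if "0 \<le> \<alpha>" "0 \<le> B" "\<And>t. 0 < t \<Longrightarrow> ((t + s) powr p - \<alpha> + B * (t + s) ^ 4) * (h1 t - h0 t) \<le> 0" for \<alpha> B
  proof (rule weighted_nn_integral_le[where u = "\<lambda>t. (t + s) ^ 4" and ?h0.0 = h0 and ?h1.0 = h1 and \<alpha> = \<alpha> and B = B])
    fix t
    show "(t + s) powr p * h1 t + \<alpha> * h0 t + B * ((t + s) ^ 4 * h1 t)
        \<le> (t + s) powr p * h0 t + \<alpha> * h1 t + B * ((t + s) ^ 4 * h0 t)"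
      using that(3)[of t] h0(2)[of t] h1(2)[of t] by (cases "0 < t") (auto simp: algebra_simps)
  qed (use nn h0 h1 mom that in auto)
  have "(0 < p \<longrightarrow> p < 4 \<longrightarrow> (\<integral>\<^sup>+t. (t + s) powr p * h0 t \<partial>lborel) \<le> (\<integral>\<^sup>+t. (t + s) powr p * h1 t \<partial>lborel))
      \<and> (p < 0 \<longrightarrow> (\<integral>\<^sup>+t. (t + s) powr p * h1 t \<partial>lborel) \<le> (\<integral>\<^sup>+t. (t + s) powr p * h0 t \<partial>lborel))"
  proof (cases "bdd_above I")
    case True
    define y where "y = Sup I"
    have up: "h1 t \<le> h0 t" if "0 < t" "y < t" for t
      using that cSup_upper[OF _ True, of t] not_I by (force simp: y_def)
    have inside: "h0 t \<le> h1 t" if t: "x < t" "t < y" for t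
    proof -
      obtain z where "z \<in> I" "t < z" using less_cSup_iff[OF ne True] t by (auto simp: y_def)
      moreover obtain w where "w \<in> I" "w < t" using above[of t] t by auto
      ultimately show ?thesis using I_interval[of w z t] I_pos by auto
    qed
    have "x \<le> y" unfolding x_def y_def using ne bdd True by (simp add: cInf_le_cSup)
    \<comment> \<open>If \<open>I\<close> were a single point, \<open>h1 \<le> h0\<close> would hold
      off that point, again against the moment inequality.\<close>
    moreover have "x \<noteq> y"
    proof
      assume "x = y"
      show False
      proof (rule absurd[of 0 x])
        fix t assume "0 < t" "t \<noteq> x"
        then have "h1 t \<le> h0 t" using below[of t] up[of t] \<open>x = y\<close> by (cases "t < x") auto
        then show "((t + s) ^ 4 - 0) * (h1 t - h0 t) \<le> 0" by (simp add: mult_nonneg_nonpos)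
      qed simp
    qed
    ultimately have xy: "0 < x + s" "x + s < y + s" using xpos s by auto
    \<comment> \<open>At the endpoints the sign of the difference is not known, but there the chord
      meets the power and the product vanishes.\<close>
    have cases: thesis if "t < x \<or> y < t \<Longrightarrow> h1 t \<le> h0 t \<Longrightarrow> thesis"
        "x < t \<Longrightarrow> t < y \<Longrightarrow> h0 t \<le> h1 t \<Longrightarrow> thesis" "t = x \<or> t = y \<Longrightarrow> thesis" "0 < t" for t thesis
      using that below[of t] up[of t] inside[of t] by argo
    show ?thesis
    proof (intro conjI impI)
      assume "0 < p" "p < 4"
      then obtain \<alpha> B where ab: "0 \<le> \<alpha>" "0 \<le> B"
        "\<And>z. x + s \<le> z \<Longrightarrow> z \<le> y + s \<Longrightarrow> \<alpha> + B * z ^ 4 \<le> z powr p"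
        "\<And>z. 0 < z \<Longrightarrow> z \<le> x + s \<or> y + s \<le> z \<Longrightarrow> z powr p \<le> \<alpha> + B * z ^ 4"
        using powr_chord_pos[OF _ _ xy] by metis
      show "(\<integral>\<^sup>+t. (t + s) powr p * h0 t \<partial>lborel) \<le> (\<integral>\<^sup>+t. (t + s) powr p * h1 t \<partial>lborel)"
      proof (rule pos[OF ab(1,2)])
        fix t :: real assume t: "0 < t"
        show "0 \<le> ((t + s) powr p - \<alpha> - B * (t + s) ^ 4) * (h1 t - h0 t)"
        proof (rule cases[of t])
          assume "t < x \<or> y < t" "h1 t \<le> h0 t"
          then show ?thesis using ab(4)[of "t + s"] t s by (intro mult_nonpos_nonpos) auto
        next
          assume "x < t" "t < y" "h0 t \<le> h1 t"
          then show ?thesis using ab(3)[of "t + s"] t s by (intro mult_nonneg_nonneg) auto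
        next
          assume "t = x \<or> t = y"
          then have "(t + s) powr p - \<alpha> - B * (t + s) ^ 4 = 0"
            using ab(3)[of "t + s"] ab(4)[of "t + s"] t s xy by auto
          then show ?thesis by simp
        qed fact
      qed
    next
      assume "p < 0"
      then obtain \<alpha> B where ab: "0 \<le> \<alpha>" "0 \<le> B"
        "\<And>z. x + s \<le> z \<Longrightarrow> z \<le> y + s \<Longrightarrow> z powr p \<le> \<alpha> - B * z ^ 4"
        "\<And>z. 0 < z \<Longrightarrow> z \<le> x + s \<or> y + s \<le> z \<Longrightarrow> \<alpha> - B * z ^ 4 \<le> z powr p"
        using powr_chord_neg[OF _ xy] by metis
      show "(\<integral>\<^sup>+t. (t + s) powr p * h1 t \<partial>lborel) \<le> (\<integral>\<^sup>+t. (t + s) powr p * h0 t \<partial>lborel)"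
      proof (rule neg[OF ab(1,2)])
        fix t :: real assume t: "0 < t"
        show "((t + s) powr p - \<alpha> + B * (t + s) ^ 4) * (h1 t - h0 t) \<le> 0"
        proof (rule cases[of t])
          assume "t < x \<or> y < t" "h1 t \<le> h0 t"
          then show ?thesis using ab(4)[of "t + s"] t s by (intro mult_nonneg_nonpos) auto
        next
          assume "x < t" "t < y" "h0 t \<le> h1 t"
          then show ?thesis using ab(3)[of "t + s"] t s by (intro mult_nonpos_nonneg) auto
        next
          assume "t = x \<or> t = y"
          then have "(t + s) powr p - \<alpha> + B * (t + s) ^ 4 = 0"
            using ab(3)[of "t + s"] ab(4)[of "t + s"] t s xy by auto
          then show ?thesis by simp
        qed fact
      qed
    qed
  next
    case False
    have inside: "h0 t \<le> h1 t" if t: "x < t" for t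
    proof -
      obtain z where "z \<in> I" "t < z" using False by (auto simp: bdd_above_def not_le)
      moreover obtain w where "w \<in> I" "w < t" using above[of t] t by auto
      ultimately show ?thesis using I_interval[of w z t] I_pos by auto
    qed
    \<comment> \<open>Only the crossing at \<open>x\<close> is left, so monotonicity of the power
      suffices: \<alpha> is its value at \<open>x + s\<close> and the slope is 0.\<close>
    show ?thesis
    proof (intro conjI impI)
      assume p: "0 < p" "p < 4"
      show "(\<integral>\<^sup>+t. (t + s) powr p * h0 t \<partial>lborel) \<le> (\<integral>\<^sup>+t. (t + s) powr p * h1 t \<partial>lborel)"
      proof (rule pos[of "(x + s) powr p" 0])
        fix t :: real assume t: "0 < t"
        show "0 \<le> ((t + s) powr p - (x + s) powr p - 0 * (t + s) ^ 4) * (h1 t - h0 t)"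
        proof (cases t x rule: linorder_cases)
          case less
          then show ?thesis using below[of t] t s p by (intro mult_nonpos_nonpos) (auto intro!: powr_mono2)
        next
          case greater
          then show ?thesis using inside[of t] xpos s p by (intro mult_nonneg_nonneg) (auto intro!: powr_mono2)
        qed simp
      qed auto
    next
      assume p: "p < 0"
      show "(\<integral>\<^sup>+t. (t + s) powr p * h1 t \<partial>lborel) \<le> (\<integral>\<^sup>+t. (t + s) powr p * h0 t \<partial>lborel)"
      proof (rule neg[of "(x + s) powr p" 0])
        fix t :: real assume t: "0 < t"
        show "((t + s) powr p - (x + s) powr p + 0 * (t + s) ^ 4) * (h1 t - h0 t) \<le> 0"
        proof (cases t x rule: linorder_cases)
          case less
          then show ?thesis using below[of t] t s p by (intro mult_nonneg_nonpos) (auto intro!: powr_mono2')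
        next
          case greater
          then show ?thesis using inside[of t] xpos s p by (intro mult_nonpos_nonneg) (auto intro!: powr_mono2')
        qed simp
      qed auto
    qed
  qed
  then show "0 < p \<Longrightarrow> p < 4 \<Longrightarrow> (\<integral>\<^sup>+t. (t + s) powr p * h0 t \<partial>lborel) \<le> (\<integral>\<^sup>+t. (t + s) powr p * h1 t \<partial>lborel)"
    and "p < 0 \<Longrightarrow> (\<integral>\<^sup>+t. (t + s) powr p * h1 t \<partial>lborel) \<le> (\<integral>\<^sup>+t. (t + s) powr p * h0 t \<partial>lborel)"
    by auto
qed

subsection \<open>Weighted sums of two exponential variables\<close>

text \<open>The density of \<open>a E\<^sub>1 + b E\<^sub>2\<close> for
  \<open>0 \<le> b \<le> a\<close> and \<open>0 < a\<close>: exponential for \<open>b = 0\<close>,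
  Erlang for \<open>a = b\<close>, hypoexponential otherwise. The value 0 at \<open>t = 0\<close>
  changes the exponential case on a null set only and makes the density vanish off the open
  half-line, as \<open>two_crossings\<close> requires.\<close>

definition hypoexp_density :: "real \<Rightarrow> real \<Rightarrow> real \<Rightarrow> real" where
  "hypoexp_density a b t =
     (if t \<le> 0 then 0
      else if b = 0 then exp (- t / a) / a
      else if a = b then t * exp (- t / a) / a\<^sup>2
      else (exp (- t / a) - exp (- t / b)) / (a - b))"

lemma hypoexp_density_nonneg:
  assumes "0 < a" "0 \<le> b" "b \<le> a"
  shows "0 \<le> hypoexp_density a b t"
  using assms by (auto simp: hypoexp_density_def divide_simps)

lemma hypoexp_density_pos:
  assumes "0 < a" "0 \<le> b" "b \<le> a" "0 < t"
  shows "0 < hypoexp_density a b t"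
  using assms by (auto simp: hypoexp_density_def divide_simps)

lemma hypoexp_density_nonpos: "t \<le> 0 \<Longrightarrow> hypoexp_density a b t = 0"
  by (simp add: hypoexp_density_def)

lemma measurable_hypoexp_density [measurable]: "hypoexp_density a b \<in> borel_measurable borel"
  unfolding hypoexp_density_def by measurable

text \<open>Minus the second derivative of the logarithm of \<open>hypoexp_density a b\<close> on
  the positive half-line.\<close>

definition hypoexp_curvature :: "real \<Rightarrow> real \<Rightarrow> real \<Rightarrow> real" where
  "hypoexp_curvature a b t =
     (if b = 0 then 0 else if a = b then 1 / t\<^sup>2
      else let d = (1 / b - 1 / a) / 2 in (d / sinh (d * t))\<^sup>2)"

lemma ln_hypoexp_density_derivs:
  assumes ab: "0 < a" "0 \<le> b" "b \<le> a"
  obtains f' where "\<And>t. 0 < t \<Longrightarrow> ((\<lambda>t. ln (hypoexp_density a b t)) has_real_derivative f' t) (at t)"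
    "\<And>t. 0 < t \<Longrightarrow> (f' has_real_derivative - hypoexp_curvature a b t) (at t)"
proof -
  have from_eq: "((\<lambda>t. ln (hypoexp_density a b t)) has_real_derivative D) (at t)"
    if "(g has_real_derivative D) (at t)" "0 < t" "\<And>t. 0 < t \<Longrightarrow> ln (hypoexp_density a b t) = g t"
    for g D t
    by (rule has_field_derivative_transform_within_open[OF that(1), where S = "{0<..}"])
      (use that in auto)
  consider "b = 0" | "b \<noteq> 0" "a = b" | "0 < b" "b < a" using ab by linarith
  then show ?thesis
  proof cases
    case 1
    show ?thesis
    proof (rule that[of "\<lambda>t. - 1 / a"])
      show "((\<lambda>t. ln (hypoexp_density a b t)) has_real_derivative - 1 / a) (at t)" if "0 < t" for t
        by (rule from_eq[where g = "\<lambda>t. - t / a - ln a"])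
          (use that ab 1 in \<open>auto intro!: derivative_eq_intros simp: hypoexp_density_def ln_div\<close>)
    qed (use 1 in \<open>auto simp: hypoexp_curvature_def\<close>)
  next
    case 2
    show ?thesis
    proof (rule that[of "\<lambda>t. 1 / t - 1 / a"])
      show "((\<lambda>t. ln (hypoexp_density a b t)) has_real_derivative 1 / t - 1 / a) (at t)" if "0 < t" for t
        by (rule from_eq[where g = "\<lambda>t. ln t - t / a - 2 * ln a"])
          (use that ab 2 in \<open>auto intro!: derivative_eq_intros simp: hypoexp_density_def ln_div ln_mult ln_realpow\<close>)
      show "((\<lambda>t. 1 / t - 1 / a) has_real_derivative - hypoexp_curvature a b t) (at t)" if "0 < t" for t
        using that 2 by (auto intro!: derivative_eq_intros simp: hypoexp_curvature_def power2_eq_square)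
    qed
  next
    case 3
    \<comment> \<open>With \<open>m\<close> the mean and \<open>d\<close> half the difference of the
      rates \<open>1 / b\<close> and \<open>1 / a\<close>, the density is a constant times
      \<open>exp (- m * t) * sinh (d * t)\<close>. Its logarithm is affine up to
      \<open>ln (sinh (d * t))\<close>, which alone contributes curvature.\<close>
    define d where "d = (1 / b - 1 / a) / 2"
    define m where "m = (1 / b + 1 / a) / 2"
    have d: "0 < d" using 3 by (simp add: d_def field_simps)
    have eq: "ln (hypoexp_density a b t) = ln (2 / (a - b)) - m * t + ln (sinh (d * t))" if "0 < t" for t
    proof -
      have e: "- t / a = - m * t + d * t" "- t / b = - m * t + - (d * t)"
        by (auto simp: m_def d_def field_simps)
      have "exp (- t / a) - exp (- t / b) = 2 * (exp (- m * t) * sinh (d * t))"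
        unfolding e exp_add sinh_def by (simp add: algebra_simps)
      then have "hypoexp_density a b t = 2 / (a - b) * (exp (- m * t) * sinh (d * t))"
        using 3 that by (simp add: hypoexp_density_def)
      moreover have "0 < sinh (d * t)" using d that by simp
      ultimately show ?thesis using 3 d that by (simp add: ln_mult_pos ln_div)
    qed
    show ?thesis
    proof (rule that[of "\<lambda>t. d * cosh (d * t) / sinh (d * t) - m"])
      fix t :: real assume t: "0 < t"
      then have s: "0 < sinh (d * t)" using d by simp
      show "((\<lambda>t. ln (hypoexp_density a b t)) has_real_derivative d * cosh (d * t) / sinh (d * t) - m) (at t)"
        by (rule from_eq[OF _ t eq]) (use s 3 in \<open>auto intro!: derivative_eq_intros\<close>)
      have "((\<lambda>t. d * cosh (d * t) / sinh (d * t) - m) has_real_derivative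
          (d * (d * sinh (d * t)) * sinh (d * t) - d * cosh (d * t) * (d * cosh (d * t))) / (sinh (d * t) * sinh (d * t))) (at t)"
        using s by (auto intro!: derivative_eq_intros simp: mult_ac)
      also have "(d * (d * sinh (d * t)) * sinh (d * t) - d * cosh (d * t) * (d * cosh (d * t))) / (sinh (d * t) * sinh (d * t))
          = - hypoexp_curvature a b t"
      proof -
        have "(d * (d * sinh (d * t)) * sinh (d * t) - d * cosh (d * t) * (d * cosh (d * t)))
            = d\<^sup>2 * ((sinh (d * t))\<^sup>2 - (cosh (d * t))\<^sup>2)" by algebra
        also have "\<dots> = - d\<^sup>2" by (simp add: cosh_square_eq)
        finally show ?thesis using 3
          by (simp add: hypoexp_curvature_def d_def[symmetric] power_divide power2_eq_square)
      qed
      finally show "((\<lambda>t. d * cosh (d * t) / sinh (d * t) - m) has_real_derivative - hypoexp_curvature a b t) (at t)" .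
    qed
  qed
qed

lemma sinh_scale_le:
  fixes x :: real
  assumes "0 \<le> x" "0 \<le> r" "r \<le> 1"
  shows "sinh (r * x) \<le> r * sinh x"
proof -
  have "convex_on {0..} (sinh :: real \<Rightarrow> real)"
    by (rule f''_ge0_imp_convex[where f' = cosh and f'' = sinh])
      (auto intro!: derivative_eq_intros)
  from convex_onD[OF this, of r 0 x] assms show ?thesis by simp
qed

lemma le_sinh:
  fixes x :: real
  assumes "0 \<le> x" shows "x \<le> sinh x"
proof -
  have "(\<lambda>y. sinh y - y) 0 \<le> (\<lambda>y. sinh y - y) x"
    by (rule DERIV_nonneg_imp_nondecreasing[OF assms])
      (auto intro!: exI derivative_eq_intros simp: cosh_real_ge_1)
  then show ?thesis by simp
qed

text \<open>Bringing the two scales closer shrinks the half-difference \<open>d\<close> of the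
  rates, and \<open>d / sinh (d * t)\<close> decreases in \<open>d\<close> because
  \<open>sinh\<close> is convex and vanishes at 0. For \<open>a' = b'\<close> its limit
  \<open>1 / t\<close> takes over, and for \<open>b = 0\<close> the left side is 0.\<close>

lemma hypoexp_curvature_mono:
  assumes ab: "0 \<le> b" "b < b'" "b' \<le> a'" "a' < a" and t: "0 < t"
  shows "hypoexp_curvature a b t \<le> hypoexp_curvature a' b' t"
proof (cases "b = 0")
  case True
  then show ?thesis by (auto simp: hypoexp_curvature_def Let_def)
next
  case False
  define d where "d = (1 / b - 1 / a) / 2"
  define d' where "d' = (1 / b' - 1 / a') / 2"
  have b: "1 / b' < 1 / b" "1 / a < 1 / a'" using ab False by (auto simp: field_simps)
  have b': "1 / a' \<le> 1 / b'" using ab False by (auto simp: field_simps)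
  have d: "0 < d" "0 \<le> d'" "d' < d" using b b' by (auto simp: d_def d'_def)
  have s: "0 < sinh (d * t)" using d t by simp
  have c: "hypoexp_curvature a b t = (d / sinh (d * t))\<^sup>2"
    using ab False by (auto simp: hypoexp_curvature_def d_def)
  show ?thesis
  proof (cases "a' = b'")
    case True
    have "d / sinh (d * t) \<le> 1 / t"
      using le_sinh[of "d * t"] d t s by (simp add: field_simps)
    then have "(d / sinh (d * t))\<^sup>2 \<le> (1 / t)\<^sup>2"
      using d s by (intro power_mono) auto
    then show ?thesis using True ab False c by (simp add: hypoexp_curvature_def power_divide)
  next
    case neq: False
    then have d': "0 < d'" using ab by (simp add: d'_def field_simps)
    have s': "0 < sinh (d' * t)" using d' t by simp
    have "sinh (d' * t) \<le> d' / d * sinh (d * t)"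
      using sinh_scale_le[of "d * t" "d' / d"] d t by simp
    then have "d / sinh (d * t) \<le> d' / sinh (d' * t)"
      using d s s' by (simp add: field_simps)
    then have "(d / sinh (d * t))\<^sup>2 \<le> (d' / sinh (d' * t))\<^sup>2"
      using d s by (intro power_mono) auto
    then show ?thesis using neq ab False c by (simp add: hypoexp_curvature_def d'_def)
  qed
qed

text \<open>The comparison of curvatures makes the difference of the log densities convex, and the
  set is its sublevel set at 0.\<close>

lemma convex_hypoexp_density_le:
  assumes ab: "0 \<le> b" "b < b'" "b' \<le> a'" "a' < a"
  shows "convex {t. 0 < t \<and> hypoexp_density a b t \<le> hypoexp_density a' b' t}"
proof -
  obtain f where f: "\<And>t. 0 < t \<Longrightarrow> ((\<lambda>t. ln (hypoexp_density a b t)) has_real_derivative f t) (at t)"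
    "\<And>t. 0 < t \<Longrightarrow> (f has_real_derivative - hypoexp_curvature a b t) (at t)"
    using ln_hypoexp_density_derivs[of a b] ab by auto
  obtain g where g: "\<And>t. 0 < t \<Longrightarrow> ((\<lambda>t. ln (hypoexp_density a' b' t)) has_real_derivative g t) (at t)"
    "\<And>t. 0 < t \<Longrightarrow> (g has_real_derivative - hypoexp_curvature a' b' t) (at t)"
    using ln_hypoexp_density_derivs[of a' b'] ab by auto
  have conv: "convex_on {0<..} (\<lambda>t. ln (hypoexp_density a b t) - ln (hypoexp_density a' b' t))"
    by (rule f''_ge0_imp_convex[where f' = "\<lambda>t. f t - g t"
          and f'' = "\<lambda>t. - hypoexp_curvature a b t - - hypoexp_curvature a' b' t"])
      (use f g in \<open>simp_all add: hypoexp_curvature_mono[OF ab] DERIV_diff del: diff_minus_eq_add\<close>)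
  have "{t. 0 < t \<and> hypoexp_density a b t \<le> hypoexp_density a' b' t}
      = {t \<in> {0<..}. ln (hypoexp_density a b t) - ln (hypoexp_density a' b' t) \<le> 0}"
    using ab by (auto simp: hypoexp_density_pos ln_le_cancel_iff)
  also have "convex \<dots>"
    unfolding convex_alt
  proof (intro ballI allI impI)
    fix x y u :: real
    assume x: "x \<in> {t \<in> {0<..}. ln (hypoexp_density a b t) - ln (hypoexp_density a' b' t) \<le> 0}"
      and y: "y \<in> {t \<in> {0<..}. ln (hypoexp_density a b t) - ln (hypoexp_density a' b' t) \<le> 0}"
      and u: "0 \<le> u \<and> u \<le> 1"
    let ?z = "(1 - u) *\<^sub>R x + u *\<^sub>R y"
    have "?z \<in> {0<..}"
      using x y u by (intro convexD_alt[of "{0<..}"]) auto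
    moreover have "ln (hypoexp_density a b ?z) - ln (hypoexp_density a' b' ?z)
        \<le> (1 - u) * (ln (hypoexp_density a b x) - ln (hypoexp_density a' b' x))
          + u * (ln (hypoexp_density a b y) - ln (hypoexp_density a' b' y))"
      using x y u by (intro convex_onD[OF conv]) auto
    moreover have "\<dots> \<le> 0"
      using x y u by (intro add_nonpos_nonpos mult_nonneg_nonpos) auto
    ultimately show "?z \<in> {t \<in> {0<..}. ln (hypoexp_density a b t) - ln (hypoexp_density a' b' t) \<le> 0}"
      by auto
  qed
  finally show ?thesis .
qed

section \<open>Integrals against the exponential law\<close>

abbreviation exp_law :: "real measure" where
  "exp_law \<equiv> density lborel (\<lambda>x. ennreal (exponential_density 1 x))"

lemma prob_space_exp_law: "prob_space exp_law"
  by (rule prob_space_exponential_density) simp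

lemma nn_integral_exp_law:
  "f \<in> borel_measurable borel \<Longrightarrow>
    (\<integral>\<^sup>+x. f x \<partial>exp_law) = (\<integral>\<^sup>+x. ennreal (exponential_density 1 x) * f x \<partial>lborel)"
  by (subst nn_integral_density) auto

lemma AE_exp_law_nonneg: "AE x in exp_law. 0 \<le> x"
  by (subst AE_density) (auto simp: exponential_density_def)

lemma emeasure_exp_law_UNIV: "emeasure exp_law UNIV = 1"
  using prob_space.emeasure_space_1[OF prob_space_exp_law] by simp

lemma nn_integral_exp_law_scale:
  fixes F :: "real \<Rightarrow> ennreal"
  assumes [measurable]: "F \<in> borel_measurable borel" and a: "0 < a"
  shows "(\<integral>\<^sup>+x. F (c + a * x) \<partial>exp_law)
    = (\<integral>\<^sup>+t. F t * ennreal (exponential_density 1 ((t - c) / a) / a) \<partial>lborel)"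
proof -
  have "(\<integral>\<^sup>+t. F t * ennreal (exponential_density 1 ((t - c) / a) / a) \<partial>lborel)
     = ennreal \<bar>a\<bar> * (\<integral>\<^sup>+x. F (c + a * x) * ennreal (exponential_density 1 ((c + a * x - c) / a) / a) \<partial>lborel)"
    using a by (intro nn_integral_real_affine) auto
  also have "\<dots> = (\<integral>\<^sup>+x. ennreal a * (F (c + a * x) * ennreal (exponential_density 1 x / a)) \<partial>lborel)"
    using a by (simp add: nn_integral_cmult)
  also have "\<dots> = (\<integral>\<^sup>+x. ennreal (exponential_density 1 x) * F (c + a * x) \<partial>lborel)"
  proof (intro nn_integral_cong)
    fix x
    have "ennreal a * ennreal (exponential_density 1 x / a) = ennreal (exponential_density 1 x)"
      using a by (subst ennreal_mult'[symmetric]) auto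
    then show "ennreal a * (F (c + a * x) * ennreal (exponential_density 1 x / a))
        = ennreal (exponential_density 1 x) * F (c + a * x)"
      by (metis mult.commute mult.left_commute)
  qed
  finally show ?thesis by (simp add: nn_integral_exp_law)
qed

lemma hypoexp_density_convolution:
  assumes b: "0 < b" "b \<le> a" and t: "t \<noteq> 0"
  shows "(\<integral>\<^sup>+y. ennreal (exponential_density 1 y) * ennreal (exponential_density 1 ((t - b * y) / a) / a) \<partial>lborel)
    = ennreal (hypoexp_density a b t)"
proof (cases "t < 0")
  case True
  have "exponential_density 1 y * exponential_density 1 ((t - b * y) / a) = 0" for y
  proof (cases "y < 0")
    case False
    then have "0 \<le> b * y" using b by simp
    then have "(t - b * y) / a < 0" using True b by (simp add: divide_neg_pos)
    then show ?thesis by (simp add: exponential_density_def)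
  qed (simp add: exponential_density_def)
  then have "(\<integral>\<^sup>+y. ennreal (exponential_density 1 y) * ennreal (exponential_density 1 ((t - b * y) / a) / a) \<partial>lborel)
      = (\<integral>\<^sup>+y. 0 \<partial>(lborel :: real measure))"
    by (intro nn_integral_cong) (metis divide_eq_0_iff ennreal_0 mult_eq_0_iff)
  then show ?thesis using True by (simp add: hypoexp_density_def)
next
  case False
  then have t: "0 < t" using t by simp
  \<comment> \<open>\<open>f\<close> is the integrand on \<open>{0..t / b}\<close>, outside of which
    one of the two densities vanishes, and \<open>G\<close> is its antiderivative. The rate
    \<open>1 - b / a\<close> is zero for \<open>a = b\<close>, hence the linear branch.\<close>
  define f where "f y = exp (- t / a) / a * exp (- (1 - b / a) * y)" for y
  define G where "G y = (if a = b then exp (- t / a) / a * y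
      else - exp (- t / a) / (a - b) * exp (- (1 - b / a) * y))" for y
  have "(\<integral>\<^sup>+y. ennreal (exponential_density 1 y) * ennreal (exponential_density 1 ((t - b * y) / a) / a) \<partial>lborel)
      = (\<integral>\<^sup>+y. ennreal (f y) * indicator {0..t / b} y \<partial>lborel)"
  proof (rule nn_integral_cong)
    fix y
    have "0 \<le> (t - b * y) / a \<longleftrightarrow> y \<le> t / b" using b by (simp add: field_simps)
    moreover have "exp (- y) * exp (- ((t - b * y) / a)) / a = f y"
      using b by (simp add: f_def exp_add[symmetric]) (simp add: field_simps)
    ultimately show "ennreal (exponential_density 1 y) * ennreal (exponential_density 1 ((t - b * y) / a) / a)
        = ennreal (f y) * indicator {0..t / b} y"
      using b by (auto simp: exponential_density_def indicator_def ennreal_mult'[symmetric] not_less)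
  qed
  also have "\<dots> = ennreal (G (t / b) - G 0)"
  proof (rule nn_integral_FTC_Icc)
    show "0 \<le> t / b" using b t by simp
    show "f \<in> borel_measurable borel" unfolding f_def by measurable
    show "0 \<le> f y" for y using b by (simp add: f_def)
    show "(G has_real_derivative f y) (at y)" for y
    proof (cases "a = b")
      case True
      have "f y = exp (- t / a) / a" using True b by (simp add: f_def)
      then show ?thesis using True b unfolding G_def by (auto intro!: derivative_eq_intros)
    next
      case False
      then have "f y = - exp (- t / a) / (a - b) * (exp (- (1 - b / a) * y) * (- (1 - b / a)))"
        using b by (simp add: f_def divide_simps)
      then show ?thesis using False unfolding G_def
        by (auto intro!: derivative_eq_intros)
    qed
  qed
  also have "G (t / b) - G 0 = hypoexp_density a b t"
  proof (cases "a = b")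
    case True
    then show ?thesis using b t by (simp add: G_def hypoexp_density_def power2_eq_square)
  next
    case False
    have "exp (- t / a) * exp (- (1 - b / a) * (t / b)) = exp (- t / b)"
      unfolding exp_add[symmetric] using b by (simp add: field_simps)
    then have "G (t / b) - G 0 = - (exp (- t / b) / (a - b)) + exp (- t / a) / (a - b)"
      using False by (simp add: G_def)
    then show ?thesis using b t False by (simp add: hypoexp_density_def diff_divide_distrib)
  qed
  finally show ?thesis .
qed

lemma nn_integral_two_exp_law:
  fixes F :: "real \<Rightarrow> ennreal"
  assumes [measurable]: "F \<in> borel_measurable borel" and ab: "0 < a" "0 \<le> b" "b \<le> a"
  shows "(\<integral>\<^sup>+y. \<integral>\<^sup>+x. F (b * y + a * x) \<partial>exp_law \<partial>exp_law)
    = (\<integral>\<^sup>+t. F t * ennreal (hypoexp_density a b t) \<partial>lborel)"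
proof (cases "b = 0")
  case True
  have "(\<integral>\<^sup>+y. \<integral>\<^sup>+x. F (b * y + a * x) \<partial>exp_law \<partial>exp_law)
      = (\<integral>\<^sup>+t. F t * ennreal (exponential_density 1 (t / a) / a) \<partial>lborel)"
    using nn_integral_exp_law_scale[of F a 0] ab True by (simp add: emeasure_exp_law_UNIV)
  also have "\<dots> = (\<integral>\<^sup>+t. F t * ennreal (hypoexp_density a b t) \<partial>lborel)"
  \<comment> \<open>The point 0 is left out because \<open>exponential_density\<close> is 1 there
    while \<open>hypoexp_density\<close> is 0.\<close>
  proof (rule nn_integral_cong_AE, rule eventually_mono[OF AE_lborel_singleton[where c = 0]])
    fix t :: real assume "t \<noteq> 0"
    then show "F t * ennreal (exponential_density 1 (t / a) / a) = F t * ennreal (hypoexp_density a b t)"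
      using True ab by (auto simp: exponential_density_def hypoexp_density_def divide_less_0_iff)
  qed
  finally show ?thesis .
next
  case False
  then have b: "0 < b" using ab by simp
  have "(\<integral>\<^sup>+y. \<integral>\<^sup>+x. F (b * y + a * x) \<partial>exp_law \<partial>exp_law)
      = (\<integral>\<^sup>+y. ennreal (exponential_density 1 y) *
          (\<integral>\<^sup>+t. F t * ennreal (exponential_density 1 ((t - b * y) / a) / a) \<partial>lborel) \<partial>lborel)"
    using ab by (simp add: nn_integral_exp_law_scale nn_integral_exp_law)
  also have "\<dots> = (\<integral>\<^sup>+y. \<integral>\<^sup>+t. ennreal (exponential_density 1 y) *
          (F t * ennreal (exponential_density 1 ((t - b * y) / a) / a)) \<partial>lborel \<partial>lborel)"
    by (simp add: nn_integral_cmult)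
  also have "\<dots> = (\<integral>\<^sup>+t. \<integral>\<^sup>+y. ennreal (exponential_density 1 y) *
          (F t * ennreal (exponential_density 1 ((t - b * y) / a) / a)) \<partial>lborel \<partial>lborel)"
    by (rule lborel_pair.Fubini') measurable
  also have "\<dots> = (\<integral>\<^sup>+t. F t * (\<integral>\<^sup>+y. ennreal (exponential_density 1 y) *
          ennreal (exponential_density 1 ((t - b * y) / a) / a) \<partial>lborel) \<partial>lborel)"
    by (simp add: nn_integral_cmult[symmetric] mult.left_commute)
  also have "\<dots> = (\<integral>\<^sup>+t. F t * ennreal (hypoexp_density a b t) \<partial>lborel)"
    by (rule nn_integral_cong_AE, rule eventually_mono[OF AE_lborel_singleton[where c = 0]])
      (subst hypoexp_density_convolution[OF b ab(3)]; simp)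
  finally show ?thesis .
qed

text \<open>The factors 1, 1, 2, 6, 24 are factorials, the moments of the standard exponential law;
  nonnegative coefficients let the integral in [0, \<infinity>] be split term by term.\<close>

lemma nn_integral_exp_law_quartic:
  fixes c0 c1 c2 c3 c4 :: real
  assumes c: "0 \<le> c0" "0 \<le> c1" "0 \<le> c2" "0 \<le> c3" "0 \<le> c4"
  shows "(\<integral>\<^sup>+x. ennreal (c0 + c1 * x + c2 * x ^ 2 + c3 * x ^ 3 + c4 * x ^ 4) \<partial>exp_law)
    = ennreal (c0 + c1 + 2 * c2 + 6 * c3 + 24 * c4)"
proof -
  let ?m = "\<lambda>i x. ennreal (exponential_density 1 x * x ^ i)"
  have m: "(\<integral>\<^sup>+x. ?m i x \<partial>lborel) = ennreal (fact i)" for i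
    using nn_integral_erlang_ith_moment[of 1 0 i] by simp
  have "(\<integral>\<^sup>+x. ennreal (c0 + c1 * x + c2 * x ^ 2 + c3 * x ^ 3 + c4 * x ^ 4) \<partial>exp_law)
     = (\<integral>\<^sup>+x. ennreal c0 * ?m 0 x + (ennreal c1 * ?m 1 x + (ennreal c2 * ?m 2 x
        + (ennreal c3 * ?m 3 x + ennreal c4 * ?m 4 x))) \<partial>lborel)"
  proof (subst nn_integral_exp_law, measurable, rule nn_integral_cong)
    fix x :: real
    show "ennreal (exponential_density 1 x) * ennreal (c0 + c1 * x + c2 * x ^ 2 + c3 * x ^ 3 + c4 * x ^ 4)
      = ennreal c0 * ?m 0 x + (ennreal c1 * ?m 1 x + (ennreal c2 * ?m 2 x
        + (ennreal c3 * ?m 3 x + ennreal c4 * ?m 4 x)))"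
    proof (cases "x < 0")
      case False
      then show ?thesis using c
        by (simp add: exponential_density_def ennreal_mult[symmetric] ennreal_plus[symmetric] algebra_simps
            del: ennreal_plus)
    qed (simp add: exponential_density_def)
  qed
  also have "\<dots> = ennreal c0 * ennreal (fact 0) + (ennreal c1 * ennreal (fact 1) + (ennreal c2 * ennreal (fact 2)
        + (ennreal c3 * ennreal (fact 3) + ennreal c4 * ennreal (fact 4))))"
    by (simp add: nn_integral_add nn_integral_cmult m del: fact_0 fact_1 power_0 power_one_right One_nat_def)
  also have "\<dots> = ennreal (c0 + c1 + 2 * c2 + 6 * c3 + 24 * c4)"
    using c by (simp add: ennreal_mult fact_numeral algebra_simps)
  finally show ?thesis .
qed

text \<open>The expectation of \<open>(X + s) ^ 4\<close> for \<open>X = a E\<^sub>1 + b E\<^sub>2\<close>: the \<open>k\<close>-th moment of \<open>X\<close> is \<open>k!\<close> times the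
  complete homogeneous symmetric polynomial of degree \<open>k\<close> in \<open>a\<close>, \<open>b\<close>.\<close>
definition fourth_moment :: "real \<Rightarrow> real \<Rightarrow> real \<Rightarrow> real" where
  "fourth_moment a b s = s ^ 4 + 4 * s ^ 3 * (a + b) + 12 * s\<^sup>2 * (a\<^sup>2 + a * b + b\<^sup>2)
     + 24 * s * (a ^ 3 + a\<^sup>2 * b + a * b\<^sup>2 + b ^ 3)
     + 24 * (a ^ 4 + a ^ 3 * b + a\<^sup>2 * b\<^sup>2 + a * b ^ 3 + b ^ 4)"

text \<open>The fourth power is integrated as a quartic in \<open>x\<close> and the result as a
  quartic in \<open>y\<close>, each time by \<open>nn_integral_exp_law_quartic\<close>; the
  unevaluated products such as \<open>2 * (6 * ...)\<close> follow the shape of that lemma.\<close>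

lemma nn_integral_fourth_moment:
  assumes ab: "0 < a" "0 \<le> b" "b \<le> a" and s: "0 \<le> s"
  shows "(\<integral>\<^sup>+t. (t + s) ^ 4 * hypoexp_density a b t \<partial>lborel) = ennreal (fourth_moment a b s)"
proof -
  have "(\<integral>\<^sup>+t. (t + s) ^ 4 * hypoexp_density a b t \<partial>lborel)
      = (\<integral>\<^sup>+t. ennreal ((t + s) ^ 4) * ennreal (hypoexp_density a b t) \<partial>lborel)"
    by (simp add: ennreal_mult hypoexp_density_nonneg[OF ab])
  also have "\<dots> = (\<integral>\<^sup>+y. \<integral>\<^sup>+x. ennreal ((b * y + a * x + s) ^ 4) \<partial>exp_law \<partial>exp_law)"
    using ab by (subst nn_integral_two_exp_law) auto
  also have "\<dots> = (\<integral>\<^sup>+y. ennreal ((b * y + s) ^ 4 + 4 * (b * y + s) ^ 3 * a + 2 * (6 * (b * y + s)\<^sup>2 * a\<^sup>2)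
      + 6 * (4 * (b * y + s) * a ^ 3) + 24 * a ^ 4) \<partial>exp_law)"
  proof (rule nn_integral_cong_AE, rule eventually_mono[OF AE_exp_law_nonneg])
    fix y :: real assume "0 \<le> y"
    then have c: "0 \<le> b * y + s" using ab s by simp
    have "(b * y + a * x + s) ^ 4 = (b * y + s) ^ 4 + 4 * (b * y + s) ^ 3 * a * x
        + 6 * (b * y + s)\<^sup>2 * a\<^sup>2 * x ^ 2 + 4 * (b * y + s) * a ^ 3 * x ^ 3 + a ^ 4 * x ^ 4" for x
      by algebra
    then show "(\<integral>\<^sup>+x. ennreal ((b * y + a * x + s) ^ 4) \<partial>exp_law)
      = ennreal ((b * y + s) ^ 4 + 4 * (b * y + s) ^ 3 * a + 2 * (6 * (b * y + s)\<^sup>2 * a\<^sup>2)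
        + 6 * (4 * (b * y + s) * a ^ 3) + 24 * a ^ 4)"
      using c ab by (simp only:) (rule nn_integral_exp_law_quartic; simp)
  qed
  also have "\<dots> = (\<integral>\<^sup>+y. ennreal ((s ^ 4 + 4 * a * s ^ 3 + 12 * a\<^sup>2 * s\<^sup>2 + 24 * a ^ 3 * s + 24 * a ^ 4)
      + (4 * b * s ^ 3 + 12 * a * b * s\<^sup>2 + 24 * a\<^sup>2 * b * s + 24 * a ^ 3 * b) * y
      + (6 * b\<^sup>2 * s\<^sup>2 + 12 * a * b\<^sup>2 * s + 12 * a\<^sup>2 * b\<^sup>2) * y ^ 2
      + (4 * b ^ 3 * s + 4 * a * b ^ 3) * y ^ 3 + b ^ 4 * y ^ 4) \<partial>exp_law)"
    by (intro nn_integral_cong arg_cong[where f = ennreal]) algebra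
  also have "\<dots> = ennreal (fourth_moment a b s)"
    using ab s by (subst nn_integral_exp_law_quartic)
      (auto simp: fourth_moment_def algebra_simps)
  finally show ?thesis .
qed

text \<open>With \<open>R\<close> fixed, each symmetric polynomial depends on the product
  \<open>w\<close> alone, and balancing the pair increases \<open>w\<close>. In degree 4 the
  polynomial is \<open>R\<^sup>2 - w\<^sup>2 + R * w\<close>, and its increment factors as
  \<open>(w' - w) * (R - (w + w'))\<close>, which is positive because \<open>2 * w < R\<close> and
  \<open>2 * w' \<le> R\<close>. This term gives strictness even for \<open>s = 0\<close>; the
  others increase weakly.\<close>

lemma fourth_moment_less:
  assumes ab: "0 \<le> b" "b < b'" "b' \<le> a'" "a' < a" and eq: "a\<^sup>2 + b\<^sup>2 = a'\<^sup>2 + b'\<^sup>2" and s: "0 \<le> s"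
  shows "fourth_moment a b s < fourth_moment a' b' s"
proof -
  define R where "R = a\<^sup>2 + b\<^sup>2"
  define w where "w = a * b"
  define w' where "w' = a' * b'"
  have R': "R = a'\<^sup>2 + b'\<^sup>2" using eq by (simp add: R_def)
  have "(a' - b')\<^sup>2 < (a - b)\<^sup>2" using ab by (intro power_strict_mono) auto
  then have ww: "w < w'" using R' by (simp add: R_def w_def w'_def power2_diff)
  have "0 < (a - b)\<^sup>2" "0 \<le> (a' - b')\<^sup>2" using ab by auto
  then have "2 * w < R" "2 * w' \<le> R"
    using R' by (simp_all add: R_def w_def w'_def power2_diff)
  then have "0 < (w' - w) * (R - (w + w'))" using ww by (intro mult_pos_pos) auto
  then have h4: "R\<^sup>2 - w\<^sup>2 + R * w < R\<^sup>2 - w'\<^sup>2 + R * w'"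
    by (simp add: algebra_simps power2_eq_square)
  have "(a + b)\<^sup>2 < (a' + b')\<^sup>2"
    using ww R' by (simp add: R_def w_def w'_def power2_sum)
  then have h1: "a + b < a' + b'"
    by (rule power_less_imp_less_base) (use ab in simp)
  have fm: "fourth_moment x y s = s ^ 4 + 4 * s ^ 3 * (x + y) + 12 * s\<^sup>2 * (R + x * y)
      + 24 * s * (R * (x + y)) + 24 * (R\<^sup>2 - (x * y)\<^sup>2 + R * (x * y))"
    if "R = x\<^sup>2 + y\<^sup>2" for x y
    unfolding fourth_moment_def that by algebra
  have "0 \<le> R" by (simp add: R_def)
  have "4 * s ^ 3 * (a + b) \<le> 4 * s ^ 3 * (a' + b')"
    using h1 s by (intro mult_left_mono) auto
  moreover have "12 * s\<^sup>2 * (R + w) \<le> 12 * s\<^sup>2 * (R + w')"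
    using ww by (intro mult_left_mono) auto
  moreover have "24 * s * (R * (a + b)) \<le> 24 * s * (R * (a' + b'))"
    using h1 s \<open>0 \<le> R\<close> by (intro mult_left_mono) auto
  ultimately show ?thesis
    unfolding fm[OF R_def] fm[OF R'] w_def[symmetric] w'_def[symmetric]
    using h4 by (intro add_le_less_mono add_mono) simp_all
qed

section \<open>Comparison of two exponential variables with a constant added\<close>

lemma measurable_epowr [measurable]: "(\<lambda>s. epowr s p) \<in> borel_measurable borel"
  unfolding epowr_def by measurable

lemma nn_integral_hypoexp_density:
  assumes ab: "0 < a" "0 \<le> b" "b \<le> a"
  shows "(\<integral>\<^sup>+t. hypoexp_density a b t \<partial>lborel) = 1"
  using nn_integral_two_exp_law[of "\<lambda>_. 1" a b] ab by (simp add: emeasure_exp_law_UNIV)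

lemma epowr_pair_density:
  assumes ab: "0 < a" "0 \<le> b" "b \<le> a" and s: "0 \<le> s"
  shows "(\<integral>\<^sup>+y. \<integral>\<^sup>+x. epowr (a * \<bar>x\<bar> + (b * \<bar>y\<bar> + s)) p \<partial>exp_law \<partial>exp_law)
    = (\<integral>\<^sup>+t. (t + s) powr p * hypoexp_density a b t \<partial>lborel)"
proof -
  have "(\<integral>\<^sup>+y. \<integral>\<^sup>+x. epowr (a * \<bar>x\<bar> + (b * \<bar>y\<bar> + s)) p \<partial>exp_law \<partial>exp_law)
      = (\<integral>\<^sup>+y. \<integral>\<^sup>+x. epowr (b * y + a * x + s) p \<partial>exp_law \<partial>exp_law)"
    by (intro nn_integral_cong_AE eventually_mono[OF AE_exp_law_nonneg]) (simp add: algebra_simps)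
  also have "\<dots> = (\<integral>\<^sup>+t. epowr (t + s) p * ennreal (hypoexp_density a b t) \<partial>lborel)"
    using ab by (subst nn_integral_two_exp_law) auto
  \<comment> \<open>Only \<open>t > 0\<close> counts, where the base is positive and
    \<open>epowr\<close> is an ordinary power; for \<open>t \<le> 0\<close> the density is zero,
    whatever the value of \<open>epowr\<close>.\<close>
  also have "\<dots> = (\<integral>\<^sup>+t. (t + s) powr p * hypoexp_density a b t \<partial>lborel)"
  proof (rule nn_integral_cong)
    fix t
    show "epowr (t + s) p * ennreal (hypoexp_density a b t) = ennreal ((t + s) powr p * hypoexp_density a b t)"
      using s by (cases "t \<le> 0")
        (auto simp: hypoexp_density_def[of _ _ t] epowr_def ennreal_mult' ennreal_mult''[symmetric])
  qed
  finally show ?thesis .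
qed

lemma epowr_zero_exponent [simp]: "epowr s 0 = 1"
  by (simp add: epowr_def)

lemma epowr_pair_compare:
  fixes p s :: real
  defines "K \<equiv> (\<lambda>a b. \<integral>\<^sup>+y. \<integral>\<^sup>+x. epowr (a * \<bar>x\<bar> + (b * \<bar>y\<bar> + s)) p \<partial>exp_law \<partial>exp_law)"
  assumes ab: "0 \<le> b" "b < b'" "b' \<le> a'" "a' < a" and eq: "a\<^sup>2 + b\<^sup>2 = a'\<^sup>2 + b'\<^sup>2" and s: "0 \<le> s"
  shows "0 \<le> p \<Longrightarrow> p \<le> 4 \<Longrightarrow> K a b \<le> K a' b'"
    and "p < 0 \<Longrightarrow> K a' b' \<le> K a b"
proof -
  have K: "K a b = (\<integral>\<^sup>+t. (t + s) powr p * hypoexp_density a b t \<partial>lborel)"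
    "K a' b' = (\<integral>\<^sup>+t. (t + s) powr p * hypoexp_density a' b' t \<partial>lborel)"
    unfolding K_def using ab s by (simp_all add: epowr_pair_density)
  have lt: "fourth_moment a b s < fourth_moment a' b' s"
    by (rule fourth_moment_less[OF ab eq s])
  have pos: "0 \<le> fourth_moment a b s"
    using ab s by (simp add: fourth_moment_def)
  note two_crossings[OF measurable_hypoexp_density measurable_hypoexp_density
      hypoexp_density_nonneg _ nn_integral_hypoexp_density hypoexp_density_nonneg _
      nn_integral_hypoexp_density convex_hypoexp_density_le[OF ab] s]
  note cmp = this[where p = p]
  have cmp1: "K a b \<le> K a' b'" if "0 < p" "p < 4"
    unfolding K by (rule cmp(1)) (use ab s lt pos that in \<open>auto simp: nn_integral_fourth_moment ennreal_lessI hypoexp_density_nonpos\<close>)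
  show "K a' b' \<le> K a b" if "p < 0"
    unfolding K by (rule cmp(2)) (use ab s lt pos that in \<open>auto simp: nn_integral_fourth_moment ennreal_lessI hypoexp_density_nonpos\<close>)
  show "K a b \<le> K a' b'" if p: "0 \<le> p" "p \<le> 4"
  proof -
    \<comment> \<open>The two boundary exponents lie outside \<open>two_crossings\<close>: for 0
      both expectations are 1, and for 4 the claim is the fourth-moment inequality itself.\<close>
    consider "p = 0" | "p = 4" | "0 < p" "p < 4" using p by linarith
    then show ?thesis
    proof cases
      case 1
      then show ?thesis by (simp add: K_def emeasure_exp_law_UNIV)
    next
      case 2
      have "(\<integral>\<^sup>+t. (t + s) powr p * hypoexp_density c d t \<partial>lborel)
          = (\<integral>\<^sup>+t. (t + s) ^ 4 * hypoexp_density c d t \<partial>lborel)" for c d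
      proof (rule nn_integral_cong)
        fix t
        show "ennreal ((t + s) powr p * hypoexp_density c d t) = ennreal ((t + s) ^ 4 * hypoexp_density c d t)"
          using s 2 by (cases "t \<le> 0") (simp_all add: hypoexp_density_nonpos)
      qed
      then show ?thesis
        unfolding K using ab s lt pos by (simp add: nn_integral_fourth_moment ennreal_leI)
    qed (rule cmp1)
  qed
qed

subsection \<open>Moments of the weighted sum\<close>

text \<open>The absolute values do not affect the integral; they make the base of the power nonnegative
  everywhere.\<close>
definition exp_moment :: "real \<Rightarrow> real ^ 'n \<Rightarrow> ennreal" where
  "exp_moment p x = (\<integral>\<^sup>+\<omega>. epowr (\<Sum>l\<in>UNIV. sqrt (x $ l) * \<bar>\<omega> l\<bar>) p \<partial>(\<Pi>\<^sub>M l\<in>UNIV. exp_law))"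

text \<open>Independence identifies the joint law of the variables with the product measure, and
  almost sure nonnegativity lets the absolute values be inserted.\<close>

lemma sqrt_sum_moment_eq_exp_moment:
  fixes W :: "'w measure" and E :: "'n::finite \<Rightarrow> 'w \<Rightarrow> real"
  assumes "prob_space W"
    and indep: "prob_space.indep_vars W (\<lambda>_. borel) E UNIV"
    and dist: "\<And>j. distributed W lborel (E j) (exponential_density 1)"
  shows "sqrt_sum_moment W E p = exp_moment p"
proof
  fix x :: "real ^ 'n"
  interpret prob_space W by fact
  have [measurable]: "E j \<in> borel_measurable W" for j
    using distributed_measurable[OF dist[of j]] by simp
  have law: "distr W borel (E j) = exp_law" for j
  proof -
    have "distr W borel (E j) = distr W lborel (E j)" by (rule distr_cong) auto
    also have "\<dots> = exp_law" by (rule distributed_distr_eq_density[OF dist])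
    finally show ?thesis .
  qed
  have P: "distr W (\<Pi>\<^sub>M l\<in>UNIV. borel) (\<lambda>\<omega>. \<lambda>l\<in>UNIV. E l \<omega>) = (\<Pi>\<^sub>M l\<in>UNIV. exp_law)"
    using indep by (subst (asm) indep_vars_iff_distr_eq_PiM) (auto simp: law)
  have nonneg: "AE \<omega> in W. 0 \<le> E j \<omega>" for j
  proof -
    have "AE t in distr W borel (E j). 0 \<le> t" unfolding law by (rule AE_exp_law_nonneg)
    then show ?thesis by (subst (asm) AE_distr_iff) auto
  qed
  then have "AE \<omega> in W. \<forall>j\<in>UNIV. 0 \<le> E j \<omega>" by (subst AE_finite_all) auto
  then have "sqrt_sum_moment W E p x
      = (\<integral>\<^sup>+\<omega>. epowr (\<Sum>l\<in>UNIV. sqrt (x $ l) * \<bar>(\<lambda>l\<in>UNIV. E l \<omega>) l\<bar>) p \<partial>W)"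
    unfolding sqrt_sum_moment_def by (intro nn_integral_cong_AE) (auto elim!: eventually_mono)
  also have "\<dots> = exp_moment p x"
    unfolding exp_moment_def P[symmetric] by (subst nn_integral_distr) auto
  finally show "sqrt_sum_moment W E p x = exp_moment p x" .
qed

text \<open>A product of identical laws is invariant under relabelling the coordinates.\<close>

lemma exp_moment_permute:
  fixes y :: "real ^ 'n" and \<pi> :: "'n \<Rightarrow> 'n"
  assumes "bij \<pi>"
  shows "exp_moment p (\<chi> l. y $ \<pi> l) = exp_moment p y"
proof -
  let ?P = "\<Pi>\<^sub>M l\<in>(UNIV :: 'n set). exp_law"
  have P: "distr ?P ?P (\<lambda>\<omega>. \<lambda>n\<in>UNIV. \<omega> (\<pi> n)) = ?P"
    using assms prob_space_exp_law by (intro distr_PiM_reindex) (auto simp: bij_def)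
  have m: "(\<lambda>\<omega>. \<lambda>n\<in>UNIV. \<omega> (\<pi> n)) \<in> measurable ?P ?P"
    by measurable
  have "exp_moment p (\<chi> l. y $ \<pi> l) = (\<integral>\<^sup>+\<omega>. epowr (\<Sum>l\<in>UNIV. sqrt (y $ \<pi> l) * \<bar>\<omega> l\<bar>) p \<partial>?P)"
    by (simp add: exp_moment_def)
  also have "\<dots> = (\<integral>\<^sup>+\<omega>. epowr (\<Sum>l\<in>UNIV. sqrt (y $ \<pi> l) * \<bar>(\<lambda>n\<in>UNIV. \<omega> (\<pi> n)) l\<bar>) p \<partial>?P)"
    (is "(\<integral>\<^sup>+\<omega>. ?G \<omega> \<partial>?P) = _")
    using nn_integral_distr[OF m, of ?G] unfolding P by simp
  also have "\<dots> = exp_moment p y"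
    unfolding exp_moment_def using assms
    by (simp add: sum.reindex_bij_betw[of \<pi> UNIV UNIV "\<lambda>l. sqrt (y $ l) * \<bar>\<omega> l\<bar>" for \<omega>])
  finally show ?thesis .
qed

text \<open>Tonelli's theorem, with coordinates \<open>i\<close> and \<open>j\<close> integrated
  innermost; given the others, their sum is the constant \<open>s\<close> of
  \<open>epowr_pair_compare\<close>.\<close>

lemma exp_moment_pair:
  fixes x :: "real ^ 'n"
  assumes ij: "i \<noteq> j"
  shows "exp_moment p x = (\<integral>\<^sup>+\<omega>. \<integral>\<^sup>+v. \<integral>\<^sup>+u. epowr (sqrt (x $ i) * \<bar>u\<bar> + (sqrt (x $ j) * \<bar>v\<bar>
      + (\<Sum>l\<in>UNIV - {i, j}. sqrt (x $ l) * \<bar>\<omega> l\<bar>))) p \<partial>exp_law \<partial>exp_law \<partial>(\<Pi>\<^sub>M l\<in>UNIV - {i, j}. exp_law))"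
proof -
  interpret prob_space exp_law by (rule prob_space_exp_law)
  interpret product_sigma_finite "\<lambda>_::'n. exp_law" by standard
  define R where "R = UNIV - {i, j}"
  have R: "finite R" "i \<notin> R" "j \<notin> R" by (auto simp: R_def)
  have keep: "(\<Sum>l\<in>R. sqrt (x $ l) * \<bar>fun_upd \<omega> k t l\<bar>) = (\<Sum>l\<in>R. sqrt (x $ l) * \<bar>\<omega> l\<bar>)"
    if "k \<notin> R" for \<omega> k t
    using that by (intro sum.cong) auto
  have U: "UNIV = insert i (insert j R)" by (auto simp: R_def)
  have "exp_moment p x = (\<integral>\<^sup>+\<omega>. \<integral>\<^sup>+u. epowr (\<Sum>l\<in>insert i (insert j R). sqrt (x $ l) * \<bar>fun_upd \<omega> i u l\<bar>) p
      \<partial>exp_law \<partial>(\<Pi>\<^sub>M l\<in>insert j R. exp_law))"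
    unfolding exp_moment_def by (subst (1 2) U, subst product_nn_integral_insert) (use ij R in auto)
  also have "\<dots> = (\<integral>\<^sup>+\<omega>. \<integral>\<^sup>+u. epowr (sqrt (x $ i) * \<bar>u\<bar> + (sqrt (x $ j) * \<bar>\<omega> j\<bar>
      + (\<Sum>l\<in>R. sqrt (x $ l) * \<bar>\<omega> l\<bar>))) p \<partial>exp_law \<partial>(\<Pi>\<^sub>M l\<in>insert j R. exp_law))"
    using ij R by (simp add: keep fun_upd_same fun_upd_other del: fun_upd_apply)
  also have "\<dots> = (\<integral>\<^sup>+\<omega>. \<integral>\<^sup>+v. \<integral>\<^sup>+u. epowr (sqrt (x $ i) * \<bar>u\<bar> + (sqrt (x $ j) * \<bar>v\<bar>
      + (\<Sum>l\<in>R. sqrt (x $ l) * \<bar>\<omega> l\<bar>))) p \<partial>exp_law \<partial>exp_law \<partial>(\<Pi>\<^sub>M l\<in>R. exp_law))"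
    using R by (subst product_nn_integral_insert) (auto simp add: keep fun_upd_same simp del: fun_upd_apply)
  finally show ?thesis by (simp add: R_def)
qed

lemma exp_moment_pair_update:
  fixes y :: "real ^ 'n"
  assumes y: "y \<in> nonneg_orthant" and ij: "i \<noteq> j"
    and uv: "y $ j \<le> v" "v \<le> u" "u \<le> y $ i" "u + v = y $ i + y $ j"
  shows "0 \<le> p \<Longrightarrow> p \<le> 4 \<Longrightarrow> exp_moment p y \<le> exp_moment p (pair_update y i j u v)"
    and "p < 0 \<Longrightarrow> exp_moment p (pair_update y i j u v) \<le> exp_moment p y"
proof -
  have nn: "0 \<le> y $ l" for l using y by (simp add: nonneg_orthant_def)
  have rest: "(\<Sum>l\<in>UNIV - {i, j}. sqrt (pair_update y i j u v $ l) * \<bar>\<omega> l\<bar>)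
      = (\<Sum>l\<in>UNIV - {i, j}. sqrt (y $ l) * \<bar>\<omega> l\<bar>)" for \<omega>
    by (intro sum.cong) (auto simp: pair_update_nth)
  have s: "0 \<le> (\<Sum>l\<in>UNIV - {i, j}. sqrt (y $ l) * \<bar>\<omega> l\<bar>)" for \<omega>
    by (intro sum_nonneg) (simp add: nn)
  have ends: "pair_update y i j u v $ i = u" "pair_update y i j u v $ j = v"
    using ij by (auto simp: pair_update_nth)
  have "(0 \<le> p \<longrightarrow> p \<le> 4 \<longrightarrow> exp_moment p y \<le> exp_moment p (pair_update y i j u v))
      \<and> (p < 0 \<longrightarrow> exp_moment p (pair_update y i j u v) \<le> exp_moment p y)"
  proof (cases "v = y $ j")
    case True
    then have "pair_update y i j u v = y"
      using uv by (simp add: vec_eq_iff pair_update_nth)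
    then show ?thesis by simp
  next
    case False
    then have v: "y $ j < v" "u < y $ i" using uv by auto
    \<comment> \<open>Since the weights are square roots of the entries, a transfer that preserves
      the sum moves the weights along a circle.\<close>
    have sq: "0 \<le> sqrt (y $ j)" "sqrt (y $ j) < sqrt v" "sqrt v \<le> sqrt u" "sqrt u < sqrt (y $ i)"
        "(sqrt (y $ i))\<^sup>2 + (sqrt (y $ j))\<^sup>2 = (sqrt u)\<^sup>2 + (sqrt v)\<^sup>2"
      using v uv nn[of i] nn[of j] by auto
    show ?thesis
      unfolding exp_moment_pair[OF ij] rest ends
      by (intro conjI impI nn_integral_mono epowr_pair_compare[OF sq s])
  qed
  then show "0 \<le> p \<Longrightarrow> p \<le> 4 \<Longrightarrow> exp_moment p y \<le> exp_moment p (pair_update y i j u v)"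
    and "p < 0 \<Longrightarrow> exp_moment p (pair_update y i j u v) \<le> exp_moment p y"
    by auto
qed

section \<open>Schur-convexity and Schur-concavity\<close>

lemma schur_convex_exp_moment:
  assumes "p < 0"
  shows "schur_convex_on nonneg_orthant (exp_moment p :: real ^ 'n \<Rightarrow> ennreal)"
  unfolding schur_convex_on_def
proof (intro ballI impI)
  fix x y :: "real ^ 'n"
  assume xy: "x \<in> nonneg_orthant" "y \<in> nonneg_orthant" "majorised x y"
  show "exp_moment p x \<le> exp_moment p y"
  proof (rule majorised_chain[where r = "\<lambda>a b. b \<le> a" and f = "exp_moment p", OF _ _ _ exp_moment_permute xy])
    show "exp_moment p (pair_update y i j u v) \<le> exp_moment p y"
      if "y \<in> nonneg_orthant" "i \<noteq> j" "y $ j \<le> v" "v \<le> u" "u \<le> y $ i" "u + v = y $ i + y $ j"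
      for y :: "real ^ 'n" and i j u v
      by (rule exp_moment_pair_update(2)[OF that assms])
  qed (auto intro: reflpI transpI)
qed

lemma schur_concave_exp_moment:
  assumes "0 \<le> p" "p \<le> 4"
  shows "schur_concave_on nonneg_orthant (exp_moment p :: real ^ 'n \<Rightarrow> ennreal)"
  unfolding schur_concave_on_def
proof (intro ballI impI)
  fix x y :: "real ^ 'n"
  assume xy: "x \<in> nonneg_orthant" "y \<in> nonneg_orthant" "majorised x y"
  show "exp_moment p y \<le> exp_moment p x"
  proof (rule majorised_chain[where r = "(\<le>)" and f = "exp_moment p", OF _ _ _ exp_moment_permute xy])
    show "exp_moment p (pair_update y i j u v) \<ge> exp_moment p y"
      if "y \<in> nonneg_orthant" "i \<noteq> j" "y $ j \<le> v" "v \<le> u" "u \<le> y $ i" "u + v = y $ i + y $ j"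
      for y :: "real ^ 'n" and i j u v
      by (rule exp_moment_pair_update(1)[OF that assms])
  qed (auto intro: reflpI transpI)
qed

subsection \<open>Failure of monotonicity for exponents above four\<close>

lemma nn_integral_powr_exp:
  assumes p: "-1 < p" and c: "0 < c"
  shows "(\<integral>\<^sup>+t. ennreal (indicator {0<..} t * (t powr p * exp (- t / c))) \<partial>lborel)
    = ennreal (Gamma (p + 1) * c powr (p + 1))"
proof -
  let ?f = "\<lambda>t. ennreal (indicator {0..} t * t powr p / exp t)"
  have "(\<integral>\<^sup>+t. ennreal (indicator {0<..} t * (t powr p * exp (- t / c))) \<partial>lborel)
      = ennreal \<bar>c\<bar> * (\<integral>\<^sup>+t. ennreal (indicator {0<..} (0 + c * t) * ((0 + c * t) powr p * exp (- (0 + c * t) / c))) \<partial>lborel)"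
    using c by (intro nn_integral_real_affine) auto
  also have "(\<integral>\<^sup>+t. ennreal (indicator {0<..} (0 + c * t) * ((0 + c * t) powr p * exp (- (0 + c * t) / c))) \<partial>lborel)
      = (\<integral>\<^sup>+t. ennreal (c powr p) * ?f t \<partial>lborel)"
  proof (rule nn_integral_cong_AE, rule eventually_mono[OF AE_lborel_singleton[where c = 0]])
    fix t :: real assume "t \<noteq> 0"
    then show "ennreal (indicator {0<..} (0 + c * t) * ((0 + c * t) powr p * exp (- (0 + c * t) / c)))
        = ennreal (c powr p) * ?f t"
      using c by (auto simp: indicator_def powr_mult exp_minus field_simps zero_less_mult_iff ennreal_mult[symmetric])
  qed
  also have "\<dots> = ennreal (c powr p) * ennreal (Gamma (p + 1))"
    using Gamma_conv_nn_integral_real[of "p + 1"] p by (simp add: nn_integral_cmult)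
  also have "ennreal \<bar>c\<bar> * (ennreal (c powr p) * ennreal (Gamma (p + 1))) = ennreal (Gamma (p + 1) * c powr (p + 1))"
    using c p by (simp add: ennreal_mult[symmetric] powr_add Gamma_real_pos less_imp_le mult_ac)
  finally show ?thesis .
qed

lemma exp_moment_two_entries:
  fixes x :: "real ^ 'n"
  assumes ij: "i \<noteq> j" and p: "-1 < p" and ab: "0 < a" "0 \<le> b" "b \<le> a"
    and x: "x $ i = a\<^sup>2" "x $ j = b\<^sup>2" "\<And>l. l \<noteq> i \<Longrightarrow> l \<noteq> j \<Longrightarrow> x $ l = 0"
  shows "exp_moment p x = (\<integral>\<^sup>+t. t powr p * hypoexp_density a b t \<partial>lborel)"
proof -
  interpret P: prob_space "\<Pi>\<^sub>M l\<in>UNIV - {i, j}. exp_law"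
    using prob_space_exp_law by (intro prob_space_PiM) auto
  have "(\<Sum>l\<in>UNIV - {i, j}. sqrt (x $ l) * \<bar>\<omega> l\<bar>) = 0" for \<omega>
    using x(3) by (intro sum.neutral) auto
  then show ?thesis
    unfolding exp_moment_pair[OF ij]
    using epowr_pair_density[OF ab, of 0 p] ab x by (simp add: P.emeasure_space_1)
qed

lemma hypoexp_powr_moment_single:
  assumes "-1 < p"
  shows "(\<integral>\<^sup>+t. t powr p * hypoexp_density 1 0 t \<partial>lborel) = ennreal (Gamma (p + 1))"
proof -
  have "(\<integral>\<^sup>+t. t powr p * hypoexp_density 1 0 t \<partial>lborel)
      = (\<integral>\<^sup>+t. ennreal (indicator {0<..} t * (t powr p * exp (- t / 1))) \<partial>lborel)"
    by (intro nn_integral_cong) (auto simp: hypoexp_density_def indicator_def)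
  then show ?thesis using nn_integral_powr_exp[OF assms, of 1] by simp
qed

lemma hypoexp_powr_moment_equal:
  assumes "-1 < p"
  shows "(\<integral>\<^sup>+t. t powr p * hypoexp_density 1 1 t \<partial>lborel) = ennreal ((p + 1) * Gamma (p + 1))"
proof -
  have "(\<integral>\<^sup>+t. t powr p * hypoexp_density 1 1 t \<partial>lborel)
      = (\<integral>\<^sup>+t. ennreal (indicator {0<..} t * (t powr (p + 1) * exp (- t / 1))) \<partial>lborel)"
    by (intro nn_integral_cong) (auto simp: hypoexp_density_def indicator_def powr_add)
  also have "\<dots> = ennreal (Gamma (p + 1 + 1))"
    using nn_integral_powr_exp[of "p + 1" 1] assms by simp
  also have "Gamma (p + 1 + 1) = (p + 1) * Gamma (p + 1)"
    using assms by (intro Gamma_plus1) auto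
  finally show ?thesis .
qed

lemma hypoexp_powr_moment_distinct:
  assumes p: "-1 < p" and ab: "0 < b" "b < a"
  shows "(\<integral>\<^sup>+t. t powr p * hypoexp_density a b t \<partial>lborel)
    = ennreal (Gamma (p + 1) * ((a powr (p + 1) - b powr (p + 1)) / (a - b)))"
proof -
  let ?e = "\<lambda>c t. indicator {0<..} t * (t powr p * exp (- t / c)) :: real"
  \<comment> \<open>This makes the truncated subtraction of extended nonnegative reals a true
    difference.\<close>
  have le: "?e b t \<le> ?e a t" for t
    using ab by (auto simp: indicator_def divide_simps mult_left_mono)
  have G: "0 < Gamma (p + 1)" using p by (intro Gamma_real_pos) auto
  have "(\<integral>\<^sup>+t. t powr p * hypoexp_density a b t \<partial>lborel)
      = (\<integral>\<^sup>+t. ennreal (1 / (a - b)) * (ennreal (?e a t) - ennreal (?e b t)) \<partial>lborel)"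
  proof (rule nn_integral_cong)
    fix t
    have "ennreal (1 / (a - b)) * (ennreal (?e a t) - ennreal (?e b t)) = ennreal (1 / (a - b) * (?e a t - ?e b t))"
      using le[of t] ab by (simp add: ennreal_minus ennreal_mult[symmetric])
    also have "1 / (a - b) * (?e a t - ?e b t) = t powr p * hypoexp_density a b t"
      using ab by (auto simp: hypoexp_density_def indicator_def algebra_simps diff_divide_distrib)
    finally show "ennreal (t powr p * hypoexp_density a b t)
        = ennreal (1 / (a - b)) * (ennreal (?e a t) - ennreal (?e b t))" by simp
  qed
  also have "\<dots> = ennreal (1 / (a - b)) * ((\<integral>\<^sup>+t. ?e a t \<partial>lborel) - (\<integral>\<^sup>+t. ?e b t \<partial>lborel))"
    using nn_integral_powr_exp[OF p, of b] ab le
    by (simp add: nn_integral_cmult nn_integral_diff ennreal_leI)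
  also have "\<dots> = ennreal (1 / (a - b)) * (ennreal (Gamma (p + 1) * a powr (p + 1)) - ennreal (Gamma (p + 1) * b powr (p + 1)))"
    using ab p by (simp only: nn_integral_powr_exp)
  also have "\<dots> = ennreal (Gamma (p + 1) * ((a powr (p + 1) - b powr (p + 1)) / (a - b)))"
    using ab G p by (simp add: ennreal_minus ennreal_mult[symmetric] powr_mono2 right_diff_distrib diff_divide_distrib)
  finally show ?thesis .
qed

text \<open>On the unit circle near \<open>b = 0\<close>, \<open>a\<close> differs from 1 only to
  second order in \<open>b\<close>, so \<open>a powr q - a\<close> is also of second order and the
  gain \<open>+ b\<close> dominates. The number 1 is the value of the quotient at the pair (1,
  0).\<close>

lemma spread_pair_gap:
  fixes q :: real
  assumes q: "2 \<le> q"
  obtains a b where "0 < b" "b < a" "a\<^sup>2 + b\<^sup>2 = 1" "1 < (a powr q - b powr q) / (a - b)"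
proof -
  define a where "a b = sqrt (1 - b\<^sup>2)" for b :: real
  \<comment> \<open>\<open>b powr q\<close> is replaced by its upper bound \<open>b\<^sup>2\<close>,
    so that all terms expand in integer powers of \<open>b\<close>.\<close>
  have "((\<lambda>b. (a b powr q - b\<^sup>2 - a b + b) / b) \<longlongrightarrow> 1) (at_right 0)"
    unfolding a_def by real_asymp
  then have "\<forall>\<^sub>F b in at_right 0. 0 < (a b powr q - b\<^sup>2 - a b + b) / b"
    by (rule order_tendstoD) simp
  moreover have "\<forall>\<^sub>F b in at_right 0. b < a b" unfolding a_def by real_asymp
  moreover have "\<forall>\<^sub>F b in at_right (0::real). b < 1" by real_asymp
  moreover have "\<forall>\<^sub>F b in at_right (0::real). 0 < b" by (simp add: eventually_at_right_less)
  ultimately have "\<forall>\<^sub>F b in at_right 0. 0 < b \<and> b < 1 \<and> b < a b \<and> 0 < (a b powr q - b\<^sup>2 - a b + b) / b"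
    by eventually_elim simp
  then obtain b where b: "0 < b" "b < 1" "b < a b" "0 < (a b powr q - b\<^sup>2 - a b + b) / b"
    using eventually_happens[of _ "at_right (0::real)"] by auto
  have "b powr q \<le> b powr 2" using b q by (intro powr_mono') auto
  then have "b powr q \<le> b\<^sup>2" using b by simp
  then have "a b - b < a b powr q - b powr q" using b by (simp add: zero_less_divide_iff)
  moreover have "b\<^sup>2 \<le> 1\<^sup>2" using b by (intro power_mono) auto
  ultimately show ?thesis using b
    by (intro that[of b "a b"]) (auto simp: less_divide_eq a_def)
qed

text \<open>The pair is \<open>sqrt (1 + e)\<close>, \<open>sqrt (1 - e)\<close>, a small
  perturbation of (1, 1), where the quotient extends continuously with value \<open>q\<close>.
  Positivity of \<open>D e\<close> is the claim after multiplication by \<open>a - b\<close>. For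
  \<open>q > 1\<close> the cubic coefficient \<open>q * (q - 1) * (q - 5) / 24\<close> changes sign
  at \<open>q = 5\<close>, which is the threshold \<open>p = 4\<close> for
  \<open>q = p + 1\<close>.\<close>

lemma balanced_pair_gap:
  fixes q :: real
  assumes q: "5 < q"
  obtains a b where "0 < b" "b < a" "a\<^sup>2 + b\<^sup>2 = 2" "q < (a powr q - b powr q) / (a - b)"
proof -
  define D where "D e = (1 + e) powr (q / 2) - q * (1 + e) powr (1 / 2) - (1 - e) powr (q / 2) + q * (1 - e) powr (1 / 2)"
    for e :: real
  \<comment> \<open>\<open>D\<close> is odd and its linear term vanishes, so the cubic term decides the sign.\<close>
  have "((\<lambda>e. D e / e ^ 3) \<longlongrightarrow> q * ((q / 2 - 1) * (q / 2 - 2)) / 6 - q / 8) (at_right 0)"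
    unfolding D_def by real_asymp
  moreover have "q * ((q / 2 - 1) * (q / 2 - 2)) / 6 - q / 8 = q * (q - 1) * (q - 5) / 24"
    by (simp add: field_simps)
  ultimately have "\<forall>\<^sub>F e in at_right 0. 0 < D e / e ^ 3"
    by (intro order_tendstoD) (use q in auto)
  moreover have "\<forall>\<^sub>F e in at_right (0::real). e < 1" by real_asymp
  moreover have "\<forall>\<^sub>F e in at_right (0::real). 0 < e" by (simp add: eventually_at_right_less)
  ultimately have "\<forall>\<^sub>F e in at_right 0. 0 < e \<and> e < 1 \<and> 0 < D e / e ^ 3"
    by eventually_elim simp
  then obtain e where e: "0 < e" "e < 1" "0 < D e / e ^ 3"
    using eventually_happens[of _ "at_right (0::real)"] by auto
  then have "0 < D e" by (simp add: zero_less_divide_iff)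
  moreover have "D e = (sqrt (1 + e)) powr q - q * sqrt (1 + e) - (sqrt (1 - e)) powr q + q * sqrt (1 - e)"
    using e by (simp add: D_def powr_half_sqrt[symmetric] powr_powr)
  ultimately show ?thesis using e
    by (intro that[of "sqrt (1 - e)" "sqrt (1 + e)"]) (auto simp: less_divide_eq algebra_simps)
qed

lemma not_schur_convex_exp_moment:
  fixes i j :: "'n::finite"
  assumes p: "4 < p" and ij: "i \<noteq> j"
  shows "\<not> schur_convex_on nonneg_orthant (exp_moment p :: real ^ 'n \<Rightarrow> ennreal)"
proof -
  have "2 \<le> p + 1" using p by simp
  then obtain a b where ab: "0 < b" "b < a" "a\<^sup>2 + b\<^sup>2 = 1" "1 < (a powr (p + 1) - b powr (p + 1)) / (a - b)"
    by (rule spread_pair_gap)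
  \<comment> \<open>\<open>y\<close> puts all mass on coordinate \<open>i\<close> and has moment
    \<open>Gamma (p + 1)\<close>; moving some of it to \<open>j\<close> makes the moment larger
    although \<open>x\<close> is majorised by \<open>y\<close>.\<close>
  define y :: "real ^ 'n" where "y = pair_update 0 i j 1 0"
  define x :: "real ^ 'n" where "x = pair_update y i j (a\<^sup>2) (b\<^sup>2)"
  have sq: "b\<^sup>2 \<le> a\<^sup>2" using ab by (intro power_mono) auto
  have "majorised x y"
    unfolding x_def
  proof (rule majorised_pair_update[OF ij _ sq])
    have "a\<^sup>2 \<le> 1" using ab(3) zero_le_power2[of b] by linarith
    then show "a\<^sup>2 \<le> y $ i" by (simp add: y_def pair_update_nth)
  qed (use ij ab in \<open>auto simp: y_def pair_update_nth\<close>)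
  moreover have "x \<in> nonneg_orthant" "y \<in> nonneg_orthant"
    by (auto simp: nonneg_orthant_def x_def y_def pair_update_nth)
  moreover have "exp_moment p y < exp_moment p x"
  proof -
    have "exp_moment p y = ennreal (Gamma (p + 1))"
      by (subst exp_moment_two_entries[OF ij, of p 1 0])
        (use ij p in \<open>auto simp: y_def pair_update_nth hypoexp_powr_moment_single\<close>)
    moreover have "exp_moment p x = ennreal (Gamma (p + 1) * ((a powr (p + 1) - b powr (p + 1)) / (a - b)))"
      by (subst exp_moment_two_entries[OF ij, of p a b])
        (use ij p ab in \<open>auto simp: x_def y_def pair_update_nth hypoexp_powr_moment_distinct\<close>)
    moreover have "0 < Gamma (p + 1)" using p by (intro Gamma_real_pos) auto
    ultimately show ?thesis using ab(4)
      by (simp add: ennreal_less_iff less_imp_le del: times_divide_eq_right)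
  qed
  ultimately show ?thesis unfolding schur_convex_on_def by (meson not_le)
qed

lemma not_schur_concave_exp_moment:
  fixes i j :: "'n::finite"
  assumes p: "4 < p" and ij: "i \<noteq> j"
  shows "\<not> schur_concave_on nonneg_orthant (exp_moment p :: real ^ 'n \<Rightarrow> ennreal)"
proof -
  have "5 < p + 1" using p by simp
  then obtain a b where ab: "0 < b" "b < a" "a\<^sup>2 + b\<^sup>2 = 2" "p + 1 < (a powr (p + 1) - b powr (p + 1)) / (a - b)"
    by (rule balanced_pair_gap)
  \<comment> \<open>Here \<open>x\<close> is the fully balanced pair, with moment
    \<open>(p + 1) * Gamma (p + 1)\<close>; the slightly unbalanced \<open>y\<close> majorises it
    and has the larger moment.\<close>
  define y :: "real ^ 'n" where "y = pair_update 0 i j (a\<^sup>2) (b\<^sup>2)"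
  define x :: "real ^ 'n" where "x = pair_update y i j 1 1"
  have sq: "b\<^sup>2 \<le> a\<^sup>2" using ab by (intro power_mono) auto
  have "b\<^sup>2 \<le> 1" "1 \<le> a\<^sup>2" using sq ab(3) by linarith+
  then have "majorised x y"
    unfolding x_def using ij ab(3) by (intro majorised_pair_update) (simp_all add: y_def pair_update_nth)
  moreover have "x \<in> nonneg_orthant" "y \<in> nonneg_orthant"
    by (auto simp: nonneg_orthant_def x_def y_def pair_update_nth)
  moreover have "exp_moment p x < exp_moment p y"
  proof -
    have "exp_moment p x = ennreal ((p + 1) * Gamma (p + 1))"
      by (subst exp_moment_two_entries[OF ij, of p 1 1])
        (use ij p in \<open>auto simp: x_def y_def pair_update_nth hypoexp_powr_moment_equal\<close>)
    moreover have "exp_moment p y = ennreal (Gamma (p + 1) * ((a powr (p + 1) - b powr (p + 1)) / (a - b)))"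
      by (subst exp_moment_two_entries[OF ij, of p a b])
        (use ij p ab in \<open>auto simp: y_def pair_update_nth hypoexp_powr_moment_distinct\<close>)
    moreover have "0 < Gamma (p + 1)" using p by (intro Gamma_real_pos) auto
    ultimately show ?thesis using ab(4) p
      by (simp add: ennreal_less_iff less_imp_le mult.commute[of "p + 1"] del: times_divide_eq_right)
  qed
  ultimately show ?thesis unfolding schur_concave_on_def by (meson not_le)
qed

theorem theorem5:
  fixes W :: "'w measure" and E :: "'n::finite \<Rightarrow> 'w \<Rightarrow> real"
  assumes "CARD('n) \<ge> 2"
    and "prob_space W"
    and "prob_space.indep_vars W (\<lambda>_. borel) E UNIV"
    and "\<And>j. distributed W lborel (E j) (exponential_density 1)"
  shows "(\<forall>p::real. -1 < p \<and> p < 0 \<longrightarrow>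
            schur_convex_on nonneg_orthant (sqrt_sum_moment W E p)) \<and>
         (\<forall>p::real. 0 \<le> p \<and> p \<le> 4 \<longrightarrow>
            schur_concave_on nonneg_orthant (sqrt_sum_moment W E p)) \<and>
         (\<forall>p::real. 4 < p \<longrightarrow>
            \<not> schur_convex_on nonneg_orthant (sqrt_sum_moment W E p) \<and>
            \<not> schur_concave_on nonneg_orthant (sqrt_sum_moment W E p))"
proof -
  obtain i j :: 'n where ij: "i \<noteq> j"
    using assms(1) card_le_Suc0_iff_eq[of "UNIV :: 'n set"] by auto
  show ?thesis
    unfolding sqrt_sum_moment_eq_exp_moment[OF assms(2-4)]
    by (simp add: schur_convex_exp_moment schur_concave_exp_moment
        not_schur_convex_exp_moment[OF _ ij] not_schur_concave_exp_moment[OF _ ij])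
qed

end
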